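(* Suppose that $\widetilde M:=\int_0^\infty\big(\sup_{i\in\mathcal S,u\in U}|f(s,i,u)|+\delta(s)\big)ds<\infty$ and that $f(\cdot,i,u)$ (for all $i\in\mathcal S$, $u\in U$) and $\delta(\cdot)$ are continuous on $[0,\infty)$. For any $\lambda>0$ and $\pi\in\Pi_r$, $$\pi\text{ is a regular relaxed equilibrium for }\widetilde J_\lambda\iff\widetilde\Phi_\lambda(\pi)=\pi.$$
   Context: Setting (continuous time). Fix $\ell,d\in\mathbb N$; $U\subset\mathbb R^\ell$ is compact with Lebesgue measure $\mathrm{Leb}(U)>0$; $\mathcal S=\{1,\dots,d\}$. For each $u\in U$, $q^u=(q^u_{ij})$ is a $d\times d$ rate matrix ($q^u_{ij}\ge0$ for $j\ne i$, $q^u_{ii}=-\sum_{j\ne i}q^u_{ij}$), with $i$-th row $q^u_i\in\mathbb R^d$. $\mathcal P(U)$ is the set of probability measures on $U$, $\mathcal D(U)$ the set of probability density functions on $U$ (w.r.t. Lebesgue measure, identified when a.e. equal). For $\mu\in\mathcal P(U)$, $Q^\mu_{ij}:=\int_Uq^u_{ij}\mu(du)$, with $i$-th row $Q^\mu_i$. A relaxed feedback control is a map $\pi:\mathcal S\to\mathcal P(U)$; $\Pi$ is the set of all of them. Under $\pi$, $X^\pi$ is the continuous-time $\mathcal S$-valued Markov chain whose generator has $i$-th row $Q^{\pi(i)}_i$. $\mathbb E_i$ is expectation given $X_0=i$. The reward is $f:[0,\infty)\times\mathcal S\times U\to\mathbb R$, and $f^\mu(t,i):=\int_Uf(t,i,u)\mu(du)$.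 The discount function $\delta:[0,\infty)\to[0,1]$ is nonincreasing with $\delta(0)=1$. For $\rho\in\mathcal D(U)$, $\mathcal H(\rho):=-\int_U\ln(\rho(u))\rho(u)\,du$. $\Pi_r$ is the set of regular relaxed feedback controls: those $\pi\in\Pi$ such that each $\pi(i)$ has a density in $\mathcal D(U)$ (identified with $\pi(i)$) with $\mathcal H(\pi(i))>-\infty$. For $\lambda>0$, $\pi\in\Pi_r$: $$\widetilde J^\pi_\lambda(i):=\mathbb E_i\Big[\int_0^\infty\big(f^{\pi(X^\pi_s)}(s,X^\pi_s)+\lambda\delta(s)\mathcal H(\pi(X^\pi_s))\big)ds\Big],\qquad \widetilde J^\pi_\lambda=(\widetilde J^\pi_\lambda(1),\dots,\widetilde J^\pi_\lambda(d))\in\mathbb R^d.$$ For $\varepsilon>0$, $\pi'\otimes_\varepsilon\pi$ means using $\pi'$ on $[0,\varepsilon)$ and $\pi$ on $[\varepsilon,\infty)$ (both for the dynamics and in the reward/entropy terms). $\pi\in\Pi_r$ is a regular relaxed equilibrium (for $\widetilde J_\lambda$) if $\limsup_{\varepsilon\downarrow0}\frac{\widetilde J_\lambda^{\pi'\otimes_\varepsilon\pi}(i)-\widetilde J_\lambda^\pi(i)}{\varepsilon}\le0$ for all $\pi'\in\Pi_r$ and $i\in\mathcal S$. $\widetilde\Gamma_\lambda:\mathbb R^d\times\mathcal S\to\mathcal D(U)$ is $$\widetilde\Gamma_\lambda(y,i)(u):=\frac{e^{\frac1\lambda(f(0,i,u)+q^u_i\cdot y)}}{\int_Ue^{\frac1\lambda(f(0,i,v)+q^v_i\cdot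 y)}dv},$$ and $\widetilde\Phi_\lambda:\Pi_r\to\Pi_r$ is $\widetilde\Phi_\lambda(\pi):=\widetilde\Gamma_\lambda(\widetilde J^\pi_\lambda,\cdot)$.
   Formalization: Adds that |f| is bounded on [0,T]×S×U for some T>0; without it the claim fails (f may blow up as t→0 on moving bumps with f(0,·)=0). Also states that q is Borel and bounded on U and f(t,i,·) is Borel, as needed for the integrals Q^μ and f^μ. *)

theory Defs
  imports "HOL-Probability.Probability"
begin

text \<open>
  The action set is \<open>U \<subseteq> real^'l\<close>, and the state space is the finite type \<open>'d\<close> (so \<open>d = CARD('d)\<close>).
  A relaxed feedback control is a map \<open>'d \<Rightarrow> (real^'l) measure\<close>; a control that may change over time
  is a map \<open>real \<Rightarrow> 'd \<Rightarrow> (real^'l) measure\<close>.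
\<close>

definition rate_matrix :: "real^'d^'d \<Rightarrow> bool" where
  "rate_matrix A \<longleftrightarrow>
     (\<forall>i j. j \<noteq> i \<longrightarrow> 0 \<le> A $ i $ j) \<and> (\<forall>i. A $ i $ i = - (\<Sum>j\<in>UNIV - {i}. A $ i $ j))"

definition leb :: "(real^'l) set \<Rightarrow> (real^'l) measure" where
  "leb U = restrict_space lborel U"

definition prob_measures :: "(real^'l) set \<Rightarrow> (real^'l) measure set" where
  "prob_measures U = {\<mu>. prob_space \<mu> \<and> sets \<mu> = sets (restrict_space borel U)}"

text \<open>
  Elements of \<open>densities U\<close> are representatives; two of them are equal almost everywhere
  iff they induce the same measure \<open>density_measure U \<rho>\<close>.
\<close>

definition densities :: "(real^'l) set \<Rightarrow> (real^'l \<Rightarrow> real) set" where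
  "densities U = {\<rho> \<in> borel_measurable (leb U).
     (\<forall>u\<in>U. 0 \<le> \<rho> u) \<and> (\<integral>\<^sup>+u. ennreal (\<rho> u) \<partial>leb U) = 1}"

definition density_measure :: "(real^'l) set \<Rightarrow> (real^'l \<Rightarrow> real) \<Rightarrow> (real^'l) measure" where
  "density_measure U \<rho> = density (leb U) (\<lambda>u. ennreal (\<rho> u))"

text \<open>
  \<open>diff_entropy U \<rho>\<close> is \<open>- (\<integral> \<rho> ln \<rho>)\<close> as an extended real: the integral of the negative part of
  \<open>\<rho> ln \<rho>\<close> minus that of its positive part. For bounded \<open>U\<close> the first term is finite, because
  \<open>x ln x \<ge> -1/e\<close>; hence the value lies in \<open>[-\<infinity>, \<infinity>)\<close>.
\<close>

definition diff_entropy :: "(real^'l) set \<Rightarrow> (real^'l \<Rightarrow> real) \<Rightarrow> ereal" where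
  "diff_entropy U \<rho> =
     enn2ereal (\<integral>\<^sup>+u. ennreal (- (ln (\<rho> u) * \<rho> u)) \<partial>leb U)
     - enn2ereal (\<integral>\<^sup>+u. ennreal (ln (\<rho> u) * \<rho> u) \<partial>leb U)"

text \<open>The entropy of an absolutely continuous measure is the entropy of its Lebesgue density.\<close>

definition measure_entropy :: "(real^'l) set \<Rightarrow> (real^'l) measure \<Rightarrow> ereal" where
  "measure_entropy U \<mu> = diff_entropy U (\<lambda>u. enn2real (RN_deriv (leb U) \<mu> u))"

definition relaxed_controls :: "(real^'l) set \<Rightarrow> ('d \<Rightarrow> (real^'l) measure) set" where
  "relaxed_controls U = {\<pi>. \<forall>i. \<pi> i \<in> prob_measures U}"

definition regular_controls :: "(real^'l) set \<Rightarrow> ('d \<Rightarrow> (real^'l) measure) set" where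
  "regular_controls U = {\<pi> \<in> relaxed_controls U.
     \<forall>i. \<exists>\<rho>\<in>densities U. \<pi> i = density_measure U \<rho> \<and> diff_entropy U \<rho> > -\<infinity>}"

definition controlled_generator ::
    "(real^'l \<Rightarrow> real^'d^'d) \<Rightarrow> ('d \<Rightarrow> (real^'l) measure) \<Rightarrow> real^'d^'d" where
  "controlled_generator q \<pi> = (\<chi> i j. \<integral>u. q u $ i $ j \<partial>\<pi> i)"

text \<open>
  The transition matrices \<open>P s t\<close>, \<open>0 \<le> s \<le> t\<close>, of a (possibly time-dependent) generator \<open>G\<close> solve
  Kolmogorov's forward equation \<open>\<partial>\<^sub>t P s t = P s t ** G t\<close>, \<open>P s s = mat 1\<close>, here in integrated form
  because \<open>G\<close> may jump. For constant \<open>G\<close> this says that \<open>P s t\<close> is the matrix exponential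
  of \<open>(t - s) G\<close>.
\<close>

definition transition_function ::
    "(real \<Rightarrow> real^'d^'d) \<Rightarrow> (real \<Rightarrow> real \<Rightarrow> real^'d^'d) \<Rightarrow> bool" where
  "transition_function G P \<longleftrightarrow>
     (\<forall>s t. 0 \<le> s \<longrightarrow> s \<le> t \<longrightarrow> ((\<lambda>r. P s r ** G r) has_integral (P s t - mat 1)) {s..t})"

definition past :: "'w measure \<Rightarrow> (real \<Rightarrow> 'w \<Rightarrow> 'd) \<Rightarrow> real \<Rightarrow> 'w set set" where
  "past M X s = sigma_sets (space M) {{\<omega> \<in> space M. X r \<omega> = m} |r m. 0 \<le> r \<and> r \<le> s}"

text \<open>
  \<open>X\<close> is a right-continuous Markov chain under \<open>M\<close> with generator \<open>G\<close>, started in \<open>i\<close>. The last clause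
  is the Markov property: given the past up to time \<open>s\<close>, the conditional probability
  of \<open>X t = j\<close> on \<open>X s = k\<close> is \<open>P s t $ k $ j\<close>.
\<close>

definition markov_chain ::
    "'w measure \<Rightarrow> (real \<Rightarrow> 'w \<Rightarrow> 'd::finite) \<Rightarrow> (real \<Rightarrow> real^'d^'d) \<Rightarrow> 'd \<Rightarrow> bool" where
  "markov_chain M X G i \<longleftrightarrow>
     prob_space M \<and>
     (\<forall>t\<ge>0. X t \<in> measurable M (count_space UNIV)) \<and>
     (AE \<omega> in M. X 0 \<omega> = i) \<and>
     (\<forall>\<omega>\<in>space M. \<forall>t\<ge>0. \<forall>\<^sub>F s in at_right t. X s \<omega> = X t \<omega>) \<and>
     (\<exists>P. transition_function G P \<and>
        (\<forall>s t. 0 \<le> s \<longrightarrow> s \<le> t \<longrightarrow> (\<forall>A\<in>past M X s. \<forall>k j.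
           measure M (A \<inter> {\<omega> \<in> space M. X s \<omega> = k \<and> X t \<omega> = j})
           = measure M (A \<inter> {\<omega> \<in> space M. X s \<omega> = k}) * P s t $ k $ j)))"

definition switch ::
    "real \<Rightarrow> ('d \<Rightarrow> (real^'l) measure) \<Rightarrow> ('d \<Rightarrow> (real^'l) measure) \<Rightarrow> real \<Rightarrow> 'd \<Rightarrow> (real^'l) measure"
  where
  "switch \<epsilon> \<pi>' \<pi> = (\<lambda>t. if t < \<epsilon> then \<pi>' else \<pi>)"

definition mean_reward ::
    "(real \<Rightarrow> 'd \<Rightarrow> real^'l \<Rightarrow> real) \<Rightarrow> (real^'l) measure \<Rightarrow> real \<Rightarrow> 'd \<Rightarrow> real" where
  "mean_reward f \<mu> t i = (\<integral>u. f t i u \<partial>\<mu>)"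

text \<open>
  \<open>M c i\<close> and \<open>X c i\<close> are the probability space and the state process under the control \<open>c\<close>
  (a time-homogeneous control \<open>\<pi>\<close> being the constant function \<open>\<lambda>t. \<pi>\<close>) with initial state \<open>i\<close>.
\<close>

definition value_fn ::
    "(real^'l) set \<Rightarrow> (real \<Rightarrow> 'd::finite \<Rightarrow> real^'l \<Rightarrow> real) \<Rightarrow> (real \<Rightarrow> real) \<Rightarrow> real
     \<Rightarrow> ((real \<Rightarrow> 'd \<Rightarrow> (real^'l) measure) \<Rightarrow> 'd \<Rightarrow> 'w measure)
     \<Rightarrow> ((real \<Rightarrow> 'd \<Rightarrow> (real^'l) measure) \<Rightarrow> 'd \<Rightarrow> real \<Rightarrow> 'w \<Rightarrow> 'd)
     \<Rightarrow> (real \<Rightarrow> 'd \<Rightarrow> (real^'l) measure) \<Rightarrow> real^'d" where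
  "value_fn U f \<delta> lam M X c =
     (\<chi> i. \<integral>\<omega>. (LINT s:{0..}|lborel.
        mean_reward f (c s (X c i s \<omega>)) s (X c i s \<omega>)
        + lam * \<delta> s * real_of_ereal (measure_entropy U (c s (X c i s \<omega>)))) \<partial>M c i)"

definition regular_relaxed_equilibrium ::
    "(real^'l) set \<Rightarrow> (real \<Rightarrow> 'd::finite \<Rightarrow> real^'l \<Rightarrow> real) \<Rightarrow> (real \<Rightarrow> real) \<Rightarrow> real
     \<Rightarrow> ((real \<Rightarrow> 'd \<Rightarrow> (real^'l) measure) \<Rightarrow> 'd \<Rightarrow> 'w measure)
     \<Rightarrow> ((real \<Rightarrow> 'd \<Rightarrow> (real^'l) measure) \<Rightarrow> 'd \<Rightarrow> real \<Rightarrow> 'w \<Rightarrow> 'd)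
     \<Rightarrow> ('d \<Rightarrow> (real^'l) measure) \<Rightarrow> bool" where
  "regular_relaxed_equilibrium U f \<delta> lam M X \<pi> \<longleftrightarrow>
     \<pi> \<in> regular_controls U \<and>
     (\<forall>\<pi>'\<in>regular_controls U. \<forall>i.
        Limsup (at_right 0) (\<lambda>\<epsilon>. ereal
          ((value_fn U f \<delta> lam M X (switch \<epsilon> \<pi>' \<pi>) $ i - value_fn U f \<delta> lam M X (\<lambda>t. \<pi>) $ i) / \<epsilon>)) \<le> 0)"

definition gibbs ::
    "(real^'l) set \<Rightarrow> (real \<Rightarrow> 'd \<Rightarrow> real^'l \<Rightarrow> real) \<Rightarrow> (real^'l \<Rightarrow> real^'d^'d) \<Rightarrow> real
     \<Rightarrow> real^'d \<Rightarrow> 'd \<Rightarrow> real^'l \<Rightarrow> real" where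
  "gibbs U f q lam y i u =
     exp (1 / lam * (f 0 i u + q u $ i \<bullet> y))
     / (\<integral>v. exp (1 / lam * (f 0 i v + q v $ i \<bullet> y)) \<partial>leb U)"

definition gibbs_update ::
    "(real^'l) set \<Rightarrow> (real \<Rightarrow> 'd \<Rightarrow> real^'l \<Rightarrow> real) \<Rightarrow> (real^'l \<Rightarrow> real^'d^'d) \<Rightarrow> (real \<Rightarrow> real) \<Rightarrow> real
     \<Rightarrow> ((real \<Rightarrow> 'd \<Rightarrow> (real^'l) measure) \<Rightarrow> 'd \<Rightarrow> 'w measure)
     \<Rightarrow> ((real \<Rightarrow> 'd \<Rightarrow> (real^'l) measure) \<Rightarrow> 'd \<Rightarrow> real \<Rightarrow> 'w \<Rightarrow> 'd)
     \<Rightarrow> ('d \<Rightarrow> (real^'l) measure) \<Rightarrow> 'd \<Rightarrow> (real^'l) measure" where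
  "gibbs_update U f q \<delta> lam M X \<pi> =
     (\<lambda>i. density_measure U (gibbs U f q lam (value_fn U f \<delta> lam M X (\<lambda>t. \<pi>)) i))"

end

theory Submission
  imports Defs
begin

text \<open>
  The transition matrices solve a linear differential equation, so they are unique, and those of
  \<open>\<pi>' \<otimes>\<^sub>\<epsilon> \<pi>\<close> factor at time \<open>\<epsilon>\<close>. With \<open>V\<close> the value of \<open>\<pi>\<close>, the quotient
  \<open>(V\<^sup>\<epsilon> - V) / \<epsilon>\<close> therefore converges in component \<open>i\<close> to \<open>H \<pi>' - H \<pi>\<close>, where
  \<open>H \<pi> = \<integral> (f 0 i u + q u $ i \<bullet> V) \<pi>(i)(du) + \<lambda> \<H>(\<pi>(i))\<close>. Hence \<open>\<pi>\<close> is an equilibrium iff every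
  \<open>\<pi>(i)\<close> maximizes this entropy-regularized Hamiltonian, and by the Gibbs variational principle
  the unique maximizer is the Gibbs measure.
\<close>

section \<open>Transition functions\<close>

text \<open>Every control has its own probability space \<open>M c i\<close>, so two controlled
  chains cannot be coupled path by path; only their one-time laws can be compared. Fubini turns each
  value into a time integral of \<open>R s *v h s\<close>, where the rows of \<open>R s\<close> are
  these laws and \<open>h\<close> is the reward rate, and the rest is deterministic. Since the
  reward depends on absolute time, what remains after \<epsilon> is not \<open>V\<close> but an
  integral \<open>K \<epsilon>\<close> in which \<open>P\<close> is restarted while the reward is
  not. Uniqueness carries much weight because \<open>transition_function\<close> contains no
  Chapman-Kolmogorov identity and every initial state brings a transition function of its own.
  Integrability in time of the supremum of |f| allows this supremum to be infinite at single times;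
  the bound on \<open>f\<close> over some \<open>{0..T}\<close> gives continuity of the mean reward
  at time 0 and a Hamiltonian integrand bounded in \<open>u\<close>.\<close>

lemma bounded_bilinear_matrix_mult:
  "bounded_bilinear ((**) :: real^'n^'m \<Rightarrow> real^'k^'n \<Rightarrow> real^'k^'m)"
proof -
  have "bilinear ((**) :: real^'n^'m \<Rightarrow> real^'k^'n \<Rightarrow> real^'k^'m)"
    unfolding bilinear_def
    by (auto intro!: linearI simp: matrix_matrix_mult_def vec_eq_iff sum.distrib sum_distrib_left
        algebra_simps)
  then show ?thesis
    by (simp add: bilinear_conv_bounded_bilinear)
qed

lemma bounded_bilinear_matrix_vector_mult:
  "bounded_bilinear ((*v) :: real^'n^'m \<Rightarrow> real^'n \<Rightarrow> real^'m)"
proof -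
  have "bilinear ((*v) :: real^'n^'m \<Rightarrow> real^'n \<Rightarrow> real^'m)"
    unfolding bilinear_def
    by (auto intro!: linearI simp: matrix_vector_right_distrib matrix_vector_mult_add_rdistrib
        matrix_vector_mult_scaleR scaleR_matrix_vector_assoc)
  then show ?thesis
    by (simp add: bilinear_conv_bounded_bilinear)
qed

text \<open>\<open>has_integral\<close> alone says nothing about the regularity of \<open>Y\<close>
  and \<open>Z\<close>, so it is bootstrapped: the difference is an indefinite integral, hence
  continuous, hence so is its integrand, hence it is differentiable with derivative
  \<open>D s ** A\<close>. It starts at zero, and Gronwall keeps it there. The start
  \<open>a\<close> and the initial value \<open>C\<close> are free so that the equation can also be
  restarted at a switch.\<close>

lemma linear_integral_equation_unique:
  fixes Y Z :: "real \<Rightarrow> real^'n^'n"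
  assumes Y: "\<And>t. t \<in> {a..b} \<Longrightarrow> ((\<lambda>r. Y r ** A) has_integral (Y t - C)) {a..t}"
    and Z: "\<And>t. t \<in> {a..b} \<Longrightarrow> ((\<lambda>r. Z r ** A) has_integral (Z t - C)) {a..t}"
    and t: "t \<in> {a..b}"
  shows "Y t = Z t"
proof -
  define D where "D = (\<lambda>r. Y r - Z r)"
  interpret mm: bounded_bilinear "(**) :: real^'n^'n \<Rightarrow> real^'n^'n \<Rightarrow> real^'n^'n"
    by (rule bounded_bilinear_matrix_mult)
  have D: "((\<lambda>r. D r ** A) has_integral D t) {a..t}" if "t \<in> {a..b}" for t
    using has_integral_diff[OF Y[OF that] Z[OF that]] by (simp add: D_def mm.diff_left)
  have int: "(\<lambda>r. D r ** A) integrable_on {a..b}"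
    using D[of b] t by auto
  have D_eq: "D s = integral {a..s} (\<lambda>r. D r ** A)" if "s \<in> {a..b}" for s
    using D[OF that] by (simp add: integral_unique)
  have cont: "continuous_on {a..b} D"
    by (rule continuous_on_eq[OF indefinite_integral_continuous_1[OF int]]) (simp add: D_eq)
  then have contA: "continuous_on {a..b} (\<lambda>r. D r ** A)"
    by (intro mm.continuous_on continuous_on_const)
  have DX: "(D has_vector_derivative D s ** A) (at s within {a..b})" if "s \<in> {a..b}" for s
    by (rule has_vector_derivative_transform[OF that _ integral_has_vector_derivative[OF contA that]])
      (rule D_eq)
  have deriv: "(D has_vector_derivative D s ** A) (at s)" if "a < s" "s < b" for s
    using DX[of s] that at_within_Icc_at[of a s b] by simp
  obtain K where K: "\<And>B :: real^'n^'n. norm (B ** A) \<le> norm B * K"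
    using bounded_linear.bounded[OF mm.bounded_linear_left[of A]] by blast
  \<comment> \<open>Gronwall: the factor \<open>exp (- 2 K s)\<close> makes \<open>|D s|\<^sup>2\<close> nonincreasing.\<close>
  define w where "w = (\<lambda>s. exp (- 2 * K * s) * (D s \<bullet> D s))"
  have "w t \<le> w a"
  proof (rule DERIV_nonpos_imp_decreasing_open[of a t w])
    show "a \<le> t" using t by simp
  next
    fix s assume s: "a < s" "s < t"
    have "((\<lambda>s. D s \<bullet> D s) has_real_derivative D s \<bullet> (D s ** A) + (D s ** A) \<bullet> D s) (at s)"
      using bounded_bilinear.has_vector_derivative[OF bounded_bilinear_inner deriv[of s] deriv[of s]] s t
      by (simp add: has_real_derivative_iff_has_vector_derivative)
    then have "((\<lambda>s. D s \<bullet> D s) has_real_derivative 2 * (D s \<bullet> (D s ** A))) (at s)"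
      by (simp add: inner_commute)
    moreover have "((\<lambda>s. exp (- 2 * K * s)) has_real_derivative exp (- 2 * K * s) * (- 2 * K)) (at s)"
      by (auto intro!: derivative_eq_intros)
    ultimately have "(w has_real_derivative
        exp (- 2 * K * s) * (- 2 * K) * (D s \<bullet> D s)
        + 2 * (D s \<bullet> (D s ** A)) * exp (- 2 * K * s)) (at s)"
      unfolding w_def by (rule DERIV_mult[rotated])
    moreover have "D s \<bullet> (D s ** A) \<le> norm (D s) * (norm (D s) * K)"
      by (rule order_trans[OF norm_cauchy_schwarz mult_left_mono[OF K norm_ge_zero]])
    then have "D s \<bullet> (D s ** A) \<le> K * (D s \<bullet> D s)"
      by (simp add: dot_square_norm power2_eq_square mult.commute mult.left_commute)
    then have "exp (- 2 * K * s) * (- 2 * K) * (D s \<bullet> D s)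
        + 2 * (D s \<bullet> (D s ** A)) * exp (- 2 * K * s) \<le> 0"
      using mult_left_mono[of "D s \<bullet> (D s ** A)" "K * (D s \<bullet> D s)" "2 * exp (- 2 * K * s)"]
      by (simp add: mult_ac)
    ultimately show "\<exists>y. (w has_real_derivative y) (at s) \<and> y \<le> 0"
      by blast
  next
    show "continuous_on {a..t} w"
      unfolding w_def by (intro continuous_intros continuous_on_subset[OF cont]) (use t in auto)
  qed
  also have "w a = 0"
    using D_eq[of a] t by (simp add: w_def)
  finally have "D t \<bullet> D t \<le> 0"
    unfolding w_def by (metis exp_gt_zero mult_le_cancel_left_pos mult_zero_right)
  then have "D t = 0"
    by (metis inner_ge_zero inner_eq_zero_iff order_antisym)
  then show ?thesis
    by (simp add: D_def)
qed

text \<open>The forward equation started at \<open>a\<close> speaks about \<open>P a\<close>, and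
  nothing in \<open>transition_function\<close> relates \<open>P a\<close> to \<open>P 0\<close>.
  The restart is therefore cut out of the equation of \<open>P 0\<close> itself.\<close>

lemma transition_function_integral:
  assumes "transition_function G P" "0 \<le> a" "a \<le> t"
  shows "((\<lambda>r. P 0 r ** G r) has_integral (P 0 t - P 0 a)) {a..t}"
proof -
  have a: "((\<lambda>r. P 0 r ** G r) has_integral (P 0 a - mat 1)) {0..a}"
    and t: "((\<lambda>r. P 0 r ** G r) has_integral (P 0 t - mat 1)) {0..t}"
    using assms by (auto simp: transition_function_def)
  obtain I where I: "((\<lambda>r. P 0 r ** G r) has_integral I) {a..t}"
    using integrable_on_subinterval[OF has_integral_integrable[OF t], of a t] assms by auto
  have "P 0 t - mat 1 = P 0 a - mat 1 + I"
    using has_integral_unique[OF t has_integral_combine[OF assms(2,3) a I]] .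
  then have "I = P 0 t - P 0 a"
    by (simp add: algebra_simps)
  with I show ?thesis
    by simp
qed

lemma transition_function_0:
  assumes "transition_function G P" "0 \<le> s"
  shows "P s s = mat 1"
proof -
  have "((\<lambda>r. P s r ** G r) has_integral (P s s - mat 1)) {s..s}"
    using assms unfolding transition_function_def by blast
  then have "P s s - mat 1 = 0"
    by (rule has_integral_unique) (simp add: has_integral_refl)
  then show ?thesis
    by simp
qed

lemma transition_function_continuous:
  assumes "transition_function G P"
  shows "continuous_on {0..} (P 0)"
proof -
  have *: "continuous_on {0..b} (P 0)" if "0 \<le> b" for b
  proof -
    have I: "((\<lambda>r. P 0 r ** G r) has_integral (P 0 t - mat 1)) {0..t}" if "0 \<le> t" for t
      using assms that by (simp add: transition_function_def)
    have "continuous_on {0..b} (\<lambda>t. integral {0..t} (\<lambda>r. P 0 r ** G r) + mat 1)"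
      by (intro continuous_intros indefinite_integral_continuous_1) (use I[OF \<open>0 \<le> b\<close>] in blast)
    then show ?thesis
      by (rule continuous_on_eq) (use integral_unique[OF I] in auto)
  qed
  show ?thesis
    unfolding continuous_on_eq_continuous_within
  proof
    fix t :: real assume "t \<in> {0..}"
    then have "continuous (at t within {0..t+1}) (P 0)"
      using *[of "t+1"] by (simp add: continuous_on_eq_continuous_within)
    moreover have "at t within {0..t+1} = at t within {0..}"
      by (rule at_within_nhd[of t "{..<t+1}"]) auto
    ultimately show "continuous (at t within {0..}) (P 0)"
      by simp
  qed
qed

lemma transition_function_unique:
  assumes "transition_function (\<lambda>_. A) P" "transition_function (\<lambda>_. A) R" "0 \<le> t"
  shows "P 0 t = R 0 t"
proof (rule linear_integral_equation_unique[where A = A and Y = "P 0" and Z = "R 0"])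
  show "t \<in> {0..t}" using assms by simp
qed (use assms in \<open>auto simp: transition_function_def\<close>)

text \<open>The generator is constant on each side of \<epsilon>, so uniqueness applies twice, with
  initial values \<open>mat 1\<close> and \<open>P' 0 \<epsilon>\<close>. The second candidate
  solves its equation because the generator acts from the right, which both the time shift and left
  multiplication by \<open>P' 0 \<epsilon>\<close> respect. For \<open>A' = A\<close> this is the
  semigroup property.\<close>

lemma transition_function_switch:
  assumes P: "transition_function (\<lambda>_. A) P"
    and P': "transition_function (\<lambda>_. A') P'"
    and R: "transition_function (\<lambda>t. if t < \<epsilon> then A' else A) R"
    and "0 \<le> \<epsilon>" "0 \<le> t"
  shows "R 0 t = (if t < \<epsilon> then P' 0 t else P' 0 \<epsilon> ** P 0 (t - \<epsilon>))"
proof -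
  have early: "R 0 t = P' 0 t" if "t \<in> {0..\<epsilon>}" for t
  proof (rule linear_integral_equation_unique[where A = A' and Y = "R 0" and Z = "P' 0", OF _ _ that])
    fix s assume s: "s \<in> {0..\<epsilon>}"
    show "((\<lambda>r. P' 0 r ** A') has_integral P' 0 s - mat 1) {0..s}"
      using P' s by (simp add: transition_function_def)
    have "((\<lambda>r. R 0 r ** (if r < \<epsilon> then A' else A)) has_integral R 0 s - mat 1) {0..s}"
      using R s by (simp add: transition_function_def)
    \<comment> \<open>At \<open>r = \<epsilon>\<close> the generator has already jumped to
      \<open>A\<close>; the integral does not see this single point.\<close>
    then show "((\<lambda>r. R 0 r ** A') has_integral R 0 s - mat 1) {0..s}"
      by (rule has_integral_spike_finite[of "{\<epsilon>}", rotated 2]) (use s in auto)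
  qed
  have late: "R 0 t = P' 0 \<epsilon> ** P 0 (t - \<epsilon>)" if "\<epsilon> \<le> t" for t
  proof (rule linear_integral_equation_unique[where A = A and Y = "R 0" and Z = "\<lambda>r. P' 0 \<epsilon> ** P 0 (r - \<epsilon>)"])
    show "t \<in> {\<epsilon>..t}" using that by simp
  next
    fix s assume s: "s \<in> {\<epsilon>..t}"
    have "((\<lambda>r. R 0 r ** (if r < \<epsilon> then A' else A)) has_integral R 0 s - R 0 \<epsilon>) {\<epsilon>..s}"
      using transition_function_integral[OF R, of \<epsilon> s] s assms by simp
    then show "((\<lambda>r. R 0 r ** A) has_integral R 0 s - P' 0 \<epsilon>) {\<epsilon>..s}"
      using early[of \<epsilon>] \<open>0 \<le> \<epsilon>\<close> by (subst has_integral_cong[of _ _ "\<lambda>r. R 0 r ** (if r < \<epsilon> then A' else A)"]) auto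
    have "((\<lambda>r. P 0 r ** A) has_integral P 0 (s - \<epsilon>) - mat 1) {0..s - \<epsilon>}"
      using P s by (simp add: transition_function_def)
    from has_integral_shift_real_ivl[OF this, of "- \<epsilon>"]
    have "((\<lambda>r. P 0 (r - \<epsilon>) ** A) has_integral P 0 (s - \<epsilon>) - mat 1) {\<epsilon>..s}"
      by simp
    from has_integral_linear[OF this bounded_bilinear.bounded_linear_right[OF bounded_bilinear_matrix_mult]]
    have "((\<lambda>r. P' 0 \<epsilon> ** (P 0 (r - \<epsilon>) ** A)) has_integral P' 0 \<epsilon> ** (P 0 (s - \<epsilon>) - mat 1)) {\<epsilon>..s}"
      by (simp add: o_def)
    then show "((\<lambda>r. (P' 0 \<epsilon> ** P 0 (r - \<epsilon>)) ** A) has_integral P' 0 \<epsilon> ** P 0 (s - \<epsilon>) - P' 0 \<epsilon>) {\<epsilon>..s}"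
      by (simp add: matrix_mul_assoc bounded_bilinear.diff_right[OF bounded_bilinear_matrix_mult])
  qed
  show ?thesis
    using early[of t] late[of t] assms by auto
qed

lemma transition_function_has_vector_derivative_0:
  assumes P: "transition_function (\<lambda>_. A) P"
  shows "((P 0) has_vector_derivative A) (at_right 0)"
proof -
  have "continuous_on {0..1} (\<lambda>r. P 0 r ** A)"
    by (intro bounded_bilinear.continuous_on[OF bounded_bilinear_matrix_mult] continuous_on_const
        continuous_on_subset[OF transition_function_continuous[OF P]]) auto
  then have "((\<lambda>t. integral {0..t} (\<lambda>r. P 0 r ** A) + mat 1) has_vector_derivative P 0 0 ** A + 0)
      (at 0 within {0..1})"
    by (intro has_vector_derivative_add integral_has_vector_derivative has_vector_derivative_const) auto
  then have "(P 0 has_vector_derivative A) (at 0 within {0..1})"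
  proof (rule has_vector_derivative_transform[rotated 2, THEN has_vector_derivative_eq_rhs])
    fix t :: real assume "t \<in> {0..1}"
    then have "((\<lambda>r. P 0 r ** A) has_integral (P 0 t - mat 1)) {0..t}"
      using P by (simp add: transition_function_def)
    then show "P 0 t = integral {0..t} (\<lambda>r. P 0 r ** A) + mat 1"
      by (simp add: integral_unique)
  qed (use transition_function_0[OF P, of 0] in auto)
  then show ?thesis
    by (simp add: at_within_Icc_at_right)
qed

section \<open>One-time laws of the chain and expectations of time integrals\<close>

text \<open>This is the Markov property at \<open>s = 0\<close> with the whole space as past event
  and \<open>k = i\<close>: the conditioning event has probability one, which leaves the entry of
  \<open>P 0 t\<close>.\<close>

lemma markov_chain_law:
  fixes X :: "real \<Rightarrow> 'w \<Rightarrow> 'd::finite"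
  assumes "markov_chain M X G i"
  obtains P where "transition_function G P"
    and "\<And>t j. 0 \<le> t \<Longrightarrow> measure M {\<omega> \<in> space M. X t \<omega> = j} = P 0 t $ i $ j"
proof -
  interpret prob_space M
    using assms by (simp add: markov_chain_def)
  have X: "X t \<in> measurable M (count_space UNIV)" if "0 \<le> t" for t
    using assms that by (simp add: markov_chain_def)
  have X0: "AE \<omega> in M. X 0 \<omega> = i"
    using assms by (simp add: markov_chain_def)
  obtain P where P: "transition_function G P"
    and markov: "\<And>s t A k j. 0 \<le> s \<Longrightarrow> s \<le> t \<Longrightarrow> A \<in> past M X s \<Longrightarrow>
      measure M (A \<inter> {\<omega> \<in> space M. X s \<omega> = k \<and> X t \<omega> = j})
      = measure M (A \<inter> {\<omega> \<in> space M. X s \<omega> = k}) * P s t $ k $ j"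
    using assms unfolding markov_chain_def by blast
  have "measure M {\<omega> \<in> space M. X t \<omega> = j} = P 0 t $ i $ j" if "0 \<le> t" for t j
  proof -
    note [measurable] = X[OF that] X[OF order_refl]
    have "measure M {\<omega> \<in> space M. X t \<omega> = j} = measure M {\<omega> \<in> space M. X 0 \<omega> = i \<and> X t \<omega> = j}"
      by (rule measure_eq_AE) (use X0 in auto)
    also have "\<dots> = measure M {\<omega> \<in> space M. X 0 \<omega> = i} * P 0 t $ i $ j"
      using markov[of 0 t "space M" i j] that
      by (simp add: past_def sigma_sets_top Int_def conj_ac)
    also have "measure M {\<omega> \<in> space M. X 0 \<omega> = i} = 1"
      using X0 by (subst prob_Collect_eq_1) auto
    finally show ?thesis by simp
  qed
  with P show thesis
    by (rule that)
qed

text \<open>Fubini requires measurability in \<omega> and \<open>s\<close> jointly, whereas the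
  chain is given as measurable at each fixed time. Sampling on a grid of mesh
  \<open>1 / Suc n\<close> involves countably many times and is jointly measurable; right continuity
  then passes to the limit. The factor \<open>0 \<le> s\<close> cuts off negative times, about which
  nothing is assumed.\<close>

lemma right_continuous_process_measurable:
  fixes X :: "real \<Rightarrow> 'w \<Rightarrow> 'd::finite"
  assumes X: "\<And>t. 0 \<le> t \<Longrightarrow> X t \<in> measurable M (count_space UNIV)"
    and rc: "\<And>\<omega> t. \<omega> \<in> space M \<Longrightarrow> 0 \<le> t \<Longrightarrow> \<forall>\<^sub>F s in at_right t. X s \<omega> = X t \<omega>"
  shows "(\<lambda>(\<omega>, s). of_bool (0 \<le> s \<and> X s \<omega> = j) :: real) \<in> borel_measurable (M \<Otimes>\<^sub>M lborel)"
proof -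
  define \<nu> where "\<nu> = (\<lambda>(n::nat) (s::real). nat \<lfloor>real (Suc n) * s\<rfloor>)"
  \<comment> \<open>\<open>\<tau> n (\<nu> n s)\<close> is a grid point strictly to the right of \<open>s\<close>, where right continuity applies.\<close>
  define \<tau> where "\<tau> = (\<lambda>(n::nat) (k::nat). real (Suc k) / real (Suc n))"
  define B where "B = (\<lambda>n (\<omega>, s :: real). of_bool (0 \<le> s \<and> X (\<tau> n (\<nu> n s)) \<omega> = j) :: real)"
  have \<tau>: "s < \<tau> n (\<nu> n s)" "\<tau> n (\<nu> n s) \<le> s + inverse (real (Suc n))" if "0 \<le> s" for n s
  proof -
    have "real (\<nu> n s) = of_int \<lfloor>real (Suc n) * s\<rfloor>"
      using that by (simp add: \<nu>_def del: of_nat_Suc)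
    then have "real (Suc n) * s < real (Suc (\<nu> n s))" "real (Suc (\<nu> n s)) \<le> real (Suc n) * s + 1"
      by linarith+
    then show "s < \<tau> n (\<nu> n s)" "\<tau> n (\<nu> n s) \<le> s + inverse (real (Suc n))"
      by (simp_all add: \<tau>_def field_simps del: of_nat_Suc)
  qed
  have "B n \<in> borel_measurable (M \<Otimes>\<^sub>M lborel)" for n
  proof -
    have [measurable]: "(\<lambda>x. \<nu> n (snd x)) \<in> measurable (M \<Otimes>\<^sub>M lborel) (count_space UNIV)"
      unfolding \<nu>_def by measurable
    have "X (\<tau> n k) \<in> measurable M (count_space UNIV)" for k
      by (rule X) (simp add: \<tau>_def)
    note [measurable] = this
    have "(\<lambda>x. (\<lambda>k x. of_bool (0 \<le> snd x \<and> X (\<tau> n k) (fst x) = j) :: real) (\<nu> n (snd x)) x)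
        \<in> borel_measurable (M \<Otimes>\<^sub>M lborel)"
      by (rule measurable_compose_countable) measurable
    then show ?thesis
      by (simp add: B_def case_prod_beta)
  qed
  then show ?thesis
  proof (rule borel_measurable_LIMSEQ_real[rotated])
    fix x :: "'w \<times> real" assume "x \<in> space (M \<Otimes>\<^sub>M lborel)"
    then obtain \<omega> and s :: real where x: "x = (\<omega>, s)" "\<omega> \<in> space M"
      by (auto simp: space_pair_measure)
    have "(\<lambda>n. B n (\<omega>, s)) \<longlonglongrightarrow> of_bool (0 \<le> s \<and> X s \<omega> = j)"
    proof (cases "0 \<le> s")
      case True
      have "(\<lambda>n. s + inverse (real (Suc n))) \<longlonglongrightarrow> s + 0"
        by (intro tendsto_intros LIMSEQ_inverse_real_of_nat)
      then have "(\<lambda>n. \<tau> n (\<nu> n s)) \<longlonglongrightarrow> s"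
        by (intro tendsto_sandwich[of "\<lambda>_. s" "\<lambda>n. \<tau> n (\<nu> n s)"])
          (auto intro!: always_eventually less_imp_le \<tau> True simp del: of_nat_Suc)
      then have "filterlim (\<lambda>n. \<tau> n (\<nu> n s)) (at_right s) sequentially"
        using \<tau>(1)[OF True] by (intro tendsto_imp_filterlim_at_right) auto
      with rc[OF x(2) True] have "\<forall>\<^sub>F n in sequentially. X (\<tau> n (\<nu> n s)) \<omega> = X s \<omega>"
        by (rule eventually_compose_filterlim)
      then have "\<forall>\<^sub>F n in sequentially. B n (\<omega>, s) = of_bool (0 \<le> s \<and> X s \<omega> = j)"
        by eventually_elim (simp add: B_def)
      then show ?thesis
        by (rule tendsto_eventually)
    qed (simp add: B_def)
    then show "(\<lambda>n. B n x) \<longlonglongrightarrow> (case x of (\<omega>, s) \<Rightarrow> of_bool (0 \<le> s \<and> X s \<omega> = j))"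
      by (simp add: x)
  qed
qed

text \<open>The reward along a path is split by the visited state into the summands
  \<open>B j \<omega> s * h j s\<close>. Each is dominated by \<open>h j\<close>, which is
  integrable on the product because \<open>M\<close> has mass one, so the integrals may be exchanged
  state by state. Integrability in time of the averaged reward comes out of the same use of
  Fubini.\<close>

lemma expectation_time_integral:
  fixes X :: "real \<Rightarrow> 'w \<Rightarrow> 'd::finite" and g :: "real \<Rightarrow> 'd \<Rightarrow> real"
  assumes "prob_space M"
    and X: "\<And>t. 0 \<le> t \<Longrightarrow> X t \<in> measurable M (count_space UNIV)"
    and rc: "\<And>\<omega> t. \<omega> \<in> space M \<Longrightarrow> 0 \<le> t \<Longrightarrow> \<forall>\<^sub>F s in at_right t. X s \<omega> = X t \<omega>"
    and g: "\<And>j. set_integrable lborel {0..} (\<lambda>s. g s j)"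
  shows "(\<integral>\<omega>. (LINT s:{0..}|lborel. g s (X s \<omega>)) \<partial>M)
      = (LINT s:{0..}|lborel. \<Sum>j\<in>UNIV. measure M {\<omega> \<in> space M. X s \<omega> = j} * g s j)"
    and "set_integrable lborel {0..} (\<lambda>s. \<Sum>j\<in>UNIV. measure M {\<omega> \<in> space M. X s \<omega> = j} * g s j)"
proof -
  interpret prob_space M by fact
  interpret pair_sigma_finite M "lborel :: real measure" ..
  define h where "h = (\<lambda>j s. indicator {0..} s * g s j)"
  define B where "B = (\<lambda>j \<omega> s. of_bool (0 \<le> s \<and> X s \<omega> = j) :: real)"
  have h: "integrable lborel (h j)" for j
    using g[of j] by (simp add: set_integrable_def h_def)
  note [measurable] = borel_measurable_integrable[OF h]
  have B_meas: "(\<lambda>x. B j (fst x) (snd x)) \<in> borel_measurable (M \<Otimes>\<^sub>M lborel)" for j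
    using right_continuous_process_measurable[OF X rc, of j] by (simp add: B_def case_prod_beta)
  note [measurable] = this
  have h_pair: "integrable (M \<Otimes>\<^sub>M lborel) (\<lambda>x. h j (snd x))" for j
    by (rule Fubini_integrable) (use h in auto)
  have Bh: "integrable (M \<Otimes>\<^sub>M lborel) (\<lambda>(\<omega>, s). B j \<omega> s * h j s)" for j
  proof (rule Bochner_Integration.integrable_bound[OF h_pair[of j]])
    show "(\<lambda>(\<omega>, s). B j \<omega> s * h j s) \<in> borel_measurable (M \<Otimes>\<^sub>M lborel)"
      by (simp add: case_prod_beta)
  qed (auto simp: B_def abs_mult intro!: always_eventually)
  have Bh_int: "integrable lborel (\<lambda>s. B j \<omega> s * h j s)" if "\<omega> \<in> space M" for \<omega> j
  proof (rule Bochner_Integration.integrable_bound[OF h[of j]])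
    show "(\<lambda>s. B j \<omega> s * h j s) \<in> borel_measurable lborel"
      using measurable_Pair2[OF B_meas, OF that, of j] by simp
  qed (auto simp: B_def abs_mult)
  have law: "(\<Sum>j\<in>UNIV. \<integral>\<omega>. B j \<omega> s * h j s \<partial>M)
      = indicator {0..} s * (\<Sum>j\<in>UNIV. measure M {\<omega> \<in> space M. X s \<omega> = j} * g s j)" for s
  proof -
    have "(\<integral>\<omega>. B j \<omega> s * h j s \<partial>M)
        = indicator {0..} s * (measure M {\<omega> \<in> space M. X s \<omega> = j} * g s j)" for j
    proof (cases "0 \<le> s")
      case True
      have "(\<integral>\<omega>. B j \<omega> s \<partial>M) = (\<integral>\<omega>. indicator {\<omega> \<in> space M. X s \<omega> = j} \<omega> \<partial>M)"
        using True by (intro Bochner_Integration.integral_cong) (auto simp: B_def)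
      then show ?thesis
        using True by (simp add: h_def Int_def conj_ac)
    qed (simp add: B_def)
    then show ?thesis
      by (simp add: sum_distrib_left)
  qed
  have "(\<integral>\<omega>. (LINT s:{0..}|lborel. g s (X s \<omega>)) \<partial>M) = (\<integral>\<omega>. (\<Sum>j\<in>UNIV. \<integral>s. B j \<omega> s * h j s \<partial>lborel) \<partial>M)"
  proof (rule Bochner_Integration.integral_cong[OF refl])
    fix \<omega> assume \<omega>: "\<omega> \<in> space M"
    have "(\<Sum>j\<in>UNIV. B j \<omega> s * h j s) = indicator {0..} s * g s (X s \<omega>)" for s
    proof -
      have "(\<Sum>j\<in>UNIV. B j \<omega> s * h j s)
          = (\<Sum>j\<in>UNIV. if j = X s \<omega> then indicator {0..} s * g s j else 0)"
        by (intro sum.cong) (auto simp: B_def h_def indicator_def)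
      then show ?thesis
        by simp
    qed
    then have "(LINT s:{0..}|lborel. g s (X s \<omega>)) = (\<integral>s. (\<Sum>j\<in>UNIV. B j \<omega> s * h j s) \<partial>lborel)"
      by (simp add: set_lebesgue_integral_def)
    then show "(LINT s:{0..}|lborel. g s (X s \<omega>)) = (\<Sum>j\<in>UNIV. \<integral>s. B j \<omega> s * h j s \<partial>lborel)"
      by (simp add: Bh_int[OF \<omega>])
  qed
  also have "\<dots> = (\<Sum>j\<in>UNIV. \<integral>\<omega>. (\<integral>s. B j \<omega> s * h j s \<partial>lborel) \<partial>M)"
    using integrable_fst[OF Bh] by simp
  also have "\<dots> = (\<Sum>j\<in>UNIV. \<integral>s. (\<integral>\<omega>. B j \<omega> s * h j s \<partial>M) \<partial>lborel)"
    by (simp only: Fubini_integral[OF Bh])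
  also have "\<dots> = (\<integral>s. (\<Sum>j\<in>UNIV. \<integral>\<omega>. B j \<omega> s * h j s \<partial>M) \<partial>lborel)"
    using integrable_snd[OF Bh] by simp
  finally show "(\<integral>\<omega>. (LINT s:{0..}|lborel. g s (X s \<omega>)) \<partial>M)
      = (LINT s:{0..}|lborel. \<Sum>j\<in>UNIV. measure M {\<omega> \<in> space M. X s \<omega> = j} * g s j)"
    by (simp only: set_lebesgue_integral_def law real_scaleR_def)
  have "integrable lborel (\<lambda>s. \<Sum>j\<in>UNIV. \<integral>\<omega>. B j \<omega> s * h j s \<partial>M)"
    using integrable_snd[OF Bh] by (rule Bochner_Integration.integrable_sum)
  then show "set_integrable lborel {0..} (\<lambda>s. \<Sum>j\<in>UNIV. measure M {\<omega> \<in> space M. X s \<omega> = j} * g s j)"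
    by (simp only: set_integrable_def law real_scaleR_def)
qed

section \<open>Right derivative of the switched value\<close>

lemma has_vector_derivative_at_right_quotient:
  assumes "(f has_vector_derivative D) (at_right x)"
  shows "((\<lambda>\<epsilon>. (f (x + \<epsilon>) - f x) /\<^sub>R \<epsilon>) \<longlongrightarrow> D) (at_right 0)"
proof -
  have "((\<lambda>y. ((f y - f x) - (y - x) *\<^sub>R D) /\<^sub>R norm (y - x)) \<longlongrightarrow> 0) (at_right x)"
    using assms by (simp add: has_vector_derivative_def has_derivative_within diff_diff_eq inverse_eq_divide)
  then have "((\<lambda>\<epsilon>. ((f (x + \<epsilon>) - f x) - \<epsilon> *\<^sub>R D) /\<^sub>R norm \<epsilon>) \<longlongrightarrow> 0) (at_right 0)"
    by (subst (asm) at_right_to_0) (simp add: filterlim_filtermap add.commute)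
  then have "((\<lambda>\<epsilon>. (f (x + \<epsilon>) - f x) /\<^sub>R \<epsilon> - D) \<longlongrightarrow> 0) (at_right 0)"
    by (rule Lim_transform_eventually)
      (auto simp: eventually_at_right_less scaleR_diff_right intro: eventually_mono[OF eventually_at_right_less])
  then show ?thesis
    by (rule LIM_zero_cancel)
qed

text \<open>Continuity is assumed at the single point 0, which is where it will be known for the
  reward rate, so the fundamental theorem of calculus is used in its pointwise form.\<close>

lemma time_average_tendsto:
  fixes h :: "real \<Rightarrow> 'a::euclidean_space"
  assumes h: "set_integrable lborel {0..} h" and cont: "continuous (at 0 within {0..}) h"
  shows "((\<lambda>\<epsilon>. (LINT s:{0..<\<epsilon>}|lborel. h s) /\<^sub>R \<epsilon>) \<longlongrightarrow> h 0) (at_right 0)"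
proof -
  have int: "set_integrable lborel S h" if "S \<subseteq> {0..}" "S \<in> sets borel" for S
    using set_integrable_subset[OF h] that by simp
  have "h integrable_on {0..1}"
    by (rule set_borel_integral_eq_integral(1)[OF int]) auto
  moreover have "continuous (at 0 within {0..1}) h"
    by (rule continuous_within_subset[OF cont]) auto
  ultimately have "((\<lambda>u. integral {0..u} h) has_vector_derivative h 0) (at 0 within {0..1})"
    using integral_has_vector_derivative_continuous_at[of h 0 1 0 "{}"] by simp
  then have "((\<lambda>u. integral {0..u} h) has_vector_derivative h 0) (at_right 0)"
    by (simp add: at_within_Icc_at_right)
  from has_vector_derivative_at_right_quotient[OF this]
  have "((\<lambda>\<epsilon>. integral {0..\<epsilon>} h /\<^sub>R \<epsilon>) \<longlongrightarrow> h 0) (at_right 0)"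
    by simp
  moreover have "integral {0..\<epsilon>} h = (LINT s:{0..<\<epsilon>}|lborel. h s)" for \<epsilon>
  proof -
    have "(LINT s:{0..<\<epsilon>}|lborel. h s) = integral {0..<\<epsilon>} h"
      by (rule set_borel_integral_eq_integral(2)[OF int]) auto
    also have "\<dots> = integral {0..\<epsilon>} h"
      by (rule integral_spike_set; rule negligible_subset[of "{\<epsilon>}"]) auto
    finally show ?thesis ..
  qed
  ultimately show ?thesis
    by simp
qed

lemma matrix_vector_mult_measurable [measurable]:
  fixes F :: "'a \<Rightarrow> real^'n^'m"
  assumes "F \<in> borel_measurable N" "x \<in> borel_measurable N"
  shows "(\<lambda>s. F s *v x s) \<in> borel_measurable N"
  by (rule borel_measurable_continuous_Pair[OF assms])
    (intro bounded_bilinear.continuous_on[OF bounded_bilinear_matrix_vector_mult] continuous_intros)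

lemma shifted_matrix_integrand_measurable:
  fixes P :: "real \<Rightarrow> real^'n^'n"
  assumes P: "continuous_on {0..} P" and g: "set_integrable lborel {0..} g" and "0 \<le> \<epsilon>"
  shows "(\<lambda>s. indicator {\<epsilon>..} s *\<^sub>R (P (s - \<epsilon>) *v g s)) \<in> borel_measurable lborel"
proof -
  \<comment> \<open>\<open>P\<close> is continuous on nonnegative times; \<open>max 0\<close>
    extends it continuously to the whole line, and the indicator of \<open>{\<epsilon>..}\<close>
    hides the extension.\<close>
  have "continuous_on UNIV (\<lambda>s. P (max 0 (s - \<epsilon>)))"
    by (rule continuous_on_compose2[OF P]) (auto intro!: continuous_intros)
  then have [measurable]: "(\<lambda>s. P (max 0 (s - \<epsilon>))) \<in> borel_measurable borel"
    by (rule borel_measurable_continuous_onI)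
  have [measurable]: "(\<lambda>s. indicator {0..} s *\<^sub>R g s) \<in> borel_measurable borel"
    using borel_measurable_integrable[OF g[unfolded set_integrable_def]] by simp
  have "(\<lambda>s. indicator {\<epsilon>..} s *\<^sub>R (P (max 0 (s - \<epsilon>)) *v (indicator {0..} s *\<^sub>R g s))) \<in> borel_measurable lborel"
    by measurable
  also have "(\<lambda>s. indicator {\<epsilon>..} s *\<^sub>R (P (max 0 (s - \<epsilon>)) *v (indicator {0..} s *\<^sub>R g s)))
      = (\<lambda>s. indicator {\<epsilon>..} s *\<^sub>R (P (s - \<epsilon>) *v g s))"
    using \<open>0 \<le> \<epsilon>\<close> by (auto simp: indicator_def fun_eq_iff)
  finally show ?thesis .
qed

lemma shifted_matrix_integrable:
  fixes P :: "real \<Rightarrow> real^'n^'n"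
  assumes P: "continuous_on {0..} P" and C: "\<And>s x. 0 \<le> s \<Longrightarrow> norm (P s *v x) \<le> C * norm x"
    and g: "set_integrable lborel {0..} g" and "0 \<le> \<epsilon>"
  shows "set_integrable lborel {\<epsilon>..} (\<lambda>s. P (s - \<epsilon>) *v g s)"
  unfolding set_integrable_def
proof (rule Bochner_Integration.integrable_bound)
  show "integrable lborel (\<lambda>s. C * norm (indicator {0..} s *\<^sub>R g s))"
    using g by (intro integrable_mult_right integrable_norm) (simp add: set_integrable_def)
  show "AE s in lborel. norm (indicator {\<epsilon>..} s *\<^sub>R (P (s - \<epsilon>) *v g s)) \<le> norm (C * norm (indicator {0..} s *\<^sub>R g s))"
    using C \<open>0 \<le> \<epsilon>\<close> by (intro always_eventually allI) (auto simp: indicator_def intro: order_trans[OF _ abs_ge_self])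
qed (rule shifted_matrix_integrand_measurable[OF P g \<open>0 \<le> \<epsilon>\<close>])

text \<open>The shift falls on the continuous \<open>P\<close> while \<open>g\<close> stays in
  place, so the integrands converge pointwise, and \<open>C * norm (g s)\<close> dominates all of
  them. The result is the right continuity at 0 of the tail value.\<close>

lemma shifted_matrix_integral_tendsto:
  fixes P :: "real \<Rightarrow> real^'n^'n"
  assumes P: "continuous_on {0..} P" and C: "\<And>s x. 0 \<le> s \<Longrightarrow> norm (P s *v x) \<le> C * norm x"
    and g: "set_integrable lborel {0..} g"
  shows "((\<lambda>\<epsilon>. LINT s:{\<epsilon>..}|lborel. P (s - \<epsilon>) *v g s) \<longlongrightarrow> (LINT s:{0..}|lborel. P s *v g s)) (at_right 0)"
  unfolding tendsto_at_iff_sequentially comp_def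
proof (intro allI impI)
  fix e :: "nat \<Rightarrow> real" assume "\<forall>i. e i \<in> {0<..} - {0}" and e0: "e \<longlonglongrightarrow> 0"
  then have e: "0 < e n" for n by auto
  show "(\<lambda>n. LINT s:{e n..}|lborel. P (s - e n) *v g s) \<longlonglongrightarrow> (LINT s:{0..}|lborel. P s *v g s)"
    unfolding set_lebesgue_integral_def
  proof (rule integral_dominated_convergence)
    show "(\<lambda>s. indicator {0..} s *\<^sub>R (P s *v g s)) \<in> borel_measurable lborel"
      using shifted_matrix_integrand_measurable[OF P g, of 0] by simp
    show "(\<lambda>s. indicator {e n..} s *\<^sub>R (P (s - e n) *v g s)) \<in> borel_measurable lborel" for n
      using shifted_matrix_integrand_measurable[OF P g, of "e n"] e[of n] by simp
    show "integrable lborel (\<lambda>s. C * norm (indicator {0..} s *\<^sub>R g s))"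
      using g by (intro integrable_mult_right integrable_norm) (simp add: set_integrable_def)
    have "C * norm (g s) \<ge> 0" if "0 \<le> s" for s
      using C[OF that, of "g s"] norm_ge_zero order_trans by blast
    then show "AE s in lborel. norm (indicator {e n..} s *\<^sub>R (P (s - e n) *v g s))
        \<le> C * norm (indicator {0..} s *\<^sub>R g s)" for n
      using C e[of n] by (intro always_eventually allI) (auto simp: indicator_def)
    show "AE s in lborel. (\<lambda>n. indicator {e n..} s *\<^sub>R (P (s - e n) *v g s))
        \<longlonglongrightarrow> indicator {0..} s *\<^sub>R (P s *v g s)"
      \<comment> \<open>At \<open>s = 0\<close> every approximating integrand vanishes because
        \<open>e n > 0\<close>, while the limit \<open>P 0 *v g 0\<close> may be nonzero; this point
        is discarded.\<close>
      using AE_lborel_singleton[of 0]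
    proof eventually_elim
      case (elim s)
      show ?case
      proof (cases "0 < s")
        case True
        have ev: "\<forall>\<^sub>F n in sequentially. e n < s"
          using order_tendstoD(2)[OF e0 True] .
        have "((\<lambda>n. s - e n) \<longlongrightarrow> s - 0) sequentially"
          by (intro tendsto_intros e0)
        then have "(\<lambda>n. P (s - e n)) \<longlonglongrightarrow> P s"
          by (intro continuous_on_tendsto_compose[OF P]) (use True ev in \<open>auto elim!: eventually_mono\<close>)
        then have "(\<lambda>n. P (s - e n) *v g s) \<longlonglongrightarrow> P s *v g s"
          by (intro bounded_bilinear.tendsto[OF bounded_bilinear_matrix_vector_mult] tendsto_const)
        then have "(\<lambda>n. indicator {e n..} s *\<^sub>R (P (s - e n) *v g s)) \<longlonglongrightarrow> P s *v g s"
          by (rule Lim_transform_eventually) (use ev in \<open>auto elim!: eventually_mono\<close>)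
        then show ?thesis
          using True by simp
      next
        case False
        then have "s < 0" using elim by simp
        then have "indicator {e n..} s = (0::real)" for n
          using e[of n] by (simp add: indicator_def)
        then show ?thesis
          using \<open>s < 0\<close> by simp
      qed
    qed
  qed
qed

text \<open>
  Subtracting \<open>K \<epsilon>\<close> instead of \<open>V\<close> lets the same limit serve for the original and for the switched
  control: taking \<open>P' = P\<close> and \<open>g' = g\<close> turns the integral into \<open>V\<close> itself.
\<close>

lemma switched_value_quotient_tendsto:
  fixes g g' :: "real \<Rightarrow> real^'n"
  assumes P: "transition_function (\<lambda>_. A) P" and P': "transition_function (\<lambda>_. A') P'"
    and C: "\<And>s x. 0 \<le> s \<Longrightarrow> norm (P 0 s *v x) \<le> C * norm x"
    and C': "\<And>s x. 0 \<le> s \<Longrightarrow> norm (P' 0 s *v x) \<le> C' * norm x"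
    and g: "set_integrable lborel {0..} g" and g': "set_integrable lborel {0..} g'"
    and cont: "continuous (at 0 within {0..}) g'"
  defines "K \<equiv> \<lambda>\<epsilon>. LINT s:{\<epsilon>..}|lborel. P 0 (s - \<epsilon>) *v g s"
    and "V \<equiv> LINT s:{0..}|lborel. P 0 s *v g s"
  shows "((\<lambda>\<epsilon>. ((LINT s:{0..}|lborel. (if s < \<epsilon> then P' 0 s else P' 0 \<epsilon> ** P 0 (s - \<epsilon>))
      *v (if s < \<epsilon> then g' s else g s)) - K \<epsilon>) /\<^sub>R \<epsilon>) \<longlongrightarrow> g' 0 + A' *v V) (at_right 0)"
proof -
  let ?h = "\<lambda>s. P' 0 s *v g' s"
  let ?W = "\<lambda>\<epsilon>. LINT s:{0..}|lborel. (if s < \<epsilon> then P' 0 s else P' 0 \<epsilon> ** P 0 (s - \<epsilon>))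
      *v (if s < \<epsilon> then g' s else g s)"
  note contP = transition_function_continuous[OF P] and contP' = transition_function_continuous[OF P']
  have P'0: "P' 0 0 = mat 1"
    by (rule transition_function_0[OF P']) simp
  have h: "set_integrable lborel {0..} ?h"
    using shifted_matrix_integrable[OF contP' C' g', of 0] by simp
  have split: "?W \<epsilon> = (LINT s:{0..<\<epsilon>}|lborel. ?h s) + P' 0 \<epsilon> *v K \<epsilon>" if "0 < \<epsilon>" for \<epsilon>
  proof -
    let ?w = "\<lambda>s. (if s < \<epsilon> then P' 0 s else P' 0 \<epsilon> ** P 0 (s - \<epsilon>)) *v (if s < \<epsilon> then g' s else g s)"
    have K: "set_integrable lborel {\<epsilon>..} (\<lambda>s. P 0 (s - \<epsilon>) *v g s)"
      using shifted_matrix_integrable[OF contP C g, of \<epsilon>] that by simp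
    have "set_integrable lborel {0..<\<epsilon>} ?h"
      by (rule set_integrable_subset[OF h]) auto
    then have early: "set_integrable lborel {0..<\<epsilon>} ?w"
      by (rule set_integrable_cong[THEN iffD1, rotated 3]) auto
    have late_eq: "indicator {\<epsilon>..} s *\<^sub>R ?w s = P' 0 \<epsilon> *v (indicator {\<epsilon>..} s *\<^sub>R (P 0 (s - \<epsilon>) *v g s))" for s
      by (simp add: indicator_def matrix_vector_mul_assoc)
    have late: "set_integrable lborel {\<epsilon>..} ?w"
      unfolding set_integrable_def late_eq
      by (rule integrable_bounded_linear[OF matrix_vector_mul_bounded_linear K[unfolded set_integrable_def]])
    have "?W \<epsilon> = (LINT s:{0..<\<epsilon>} \<union> {\<epsilon>..}|lborel. ?w s)"
      using that by (simp add: ivl_disj_un)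
    also have "\<dots> = (LINT s:{0..<\<epsilon>}|lborel. ?w s) + (LINT s:{\<epsilon>..}|lborel. ?w s)"
      by (rule set_integral_Un[OF _ early late]) auto
    also have "(LINT s:{0..<\<epsilon>}|lborel. ?w s) = (LINT s:{0..<\<epsilon>}|lborel. ?h s)"
      by (rule set_lebesgue_integral_cong) auto
    also have "(LINT s:{\<epsilon>..}|lborel. ?w s) = P' 0 \<epsilon> *v K \<epsilon>"
      unfolding set_lebesgue_integral_def K_def late_eq
      by (rule integral_bounded_linear[OF matrix_vector_mul_bounded_linear K[unfolded set_integrable_def]])
    finally show ?thesis .
  qed
  have "continuous (at 0 within {0..}) (P' 0)"
    using contP' by (simp add: continuous_on_eq_continuous_within)
  then have "continuous (at 0 within {0..}) ?h"
    using cont unfolding continuous_within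
    by (rule bounded_bilinear.tendsto[OF bounded_bilinear_matrix_vector_mult])
  from time_average_tendsto[OF h this]
  have "((\<lambda>\<epsilon>. (LINT s:{0..<\<epsilon>}|lborel. ?h s) /\<^sub>R \<epsilon>) \<longlongrightarrow> g' 0) (at_right 0)"
    by (simp add: P'0)
  moreover have "((\<lambda>\<epsilon>. (P' 0 \<epsilon> - mat 1) /\<^sub>R \<epsilon>) \<longlongrightarrow> A') (at_right 0)"
    using has_vector_derivative_at_right_quotient[OF transition_function_has_vector_derivative_0[OF P']]
    by (simp add: P'0)
  moreover have "(K \<longlongrightarrow> V) (at_right 0)"
    using shifted_matrix_integral_tendsto[OF contP C g] by (simp add: K_def V_def)
  \<comment> \<open>Once \<open>K \<epsilon>\<close> is subtracted, the tail contributes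
    \<open>(P' 0 \<epsilon> - mat 1) *v K \<epsilon>\<close>. Division by \<epsilon> falls on the
    matrix factor, so convergence of \<open>K\<close> suffices here.\<close>
  ultimately have "((\<lambda>\<epsilon>. (LINT s:{0..<\<epsilon>}|lborel. ?h s) /\<^sub>R \<epsilon> + ((P' 0 \<epsilon> - mat 1) /\<^sub>R \<epsilon>) *v K \<epsilon>)
      \<longlongrightarrow> g' 0 + A' *v V) (at_right 0)"
    by (intro tendsto_add bounded_bilinear.tendsto[OF bounded_bilinear_matrix_vector_mult])
  moreover have "\<forall>\<^sub>F \<epsilon> in at_right 0. (LINT s:{0..<\<epsilon>}|lborel. ?h s) /\<^sub>R \<epsilon> + ((P' 0 \<epsilon> - mat 1) /\<^sub>R \<epsilon>) *v K \<epsilon>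
      = (?W \<epsilon> - K \<epsilon>) /\<^sub>R \<epsilon>"
  proof (rule eventually_mono[OF eventually_at_right_less[of 0]])
    fix \<epsilon> :: real assume \<epsilon>: "0 < \<epsilon>"
    show "(LINT s:{0..<\<epsilon>}|lborel. ?h s) /\<^sub>R \<epsilon> + ((P' 0 \<epsilon> - mat 1) /\<^sub>R \<epsilon>) *v K \<epsilon> = (?W \<epsilon> - K \<epsilon>) /\<^sub>R \<epsilon>"
      unfolding split[OF \<epsilon>]
      by (simp add: matrix_vector_mult_diff_rdistrib scaleR_matrix_vector_assoc[symmetric] scaleR_diff_right scaleR_add_right)
  qed
  ultimately show ?thesis
    by (rule Lim_transform_eventually)
qed

lemma switched_value_derivative:
  fixes g g' :: "real \<Rightarrow> real^'n"
  assumes P: "transition_function (\<lambda>_. A) P" and P': "transition_function (\<lambda>_. A') P'"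
    and C: "\<And>s x. 0 \<le> s \<Longrightarrow> norm (P 0 s *v x) \<le> C * norm x"
    and C': "\<And>s x. 0 \<le> s \<Longrightarrow> norm (P' 0 s *v x) \<le> C' * norm x"
    and g: "set_integrable lborel {0..} g" and g': "set_integrable lborel {0..} g'"
    and cont: "continuous (at 0 within {0..}) g" "continuous (at 0 within {0..}) g'"
  defines "V \<equiv> LINT s:{0..}|lborel. P 0 s *v g s"
  shows "((\<lambda>\<epsilon>. ((LINT s:{0..}|lborel. (if s < \<epsilon> then P' 0 s else P' 0 \<epsilon> ** P 0 (s - \<epsilon>))
      *v (if s < \<epsilon> then g' s else g s)) - V) /\<^sub>R \<epsilon>)
    \<longlongrightarrow> (g' 0 + A' *v V) - (g 0 + A *v V)) (at_right 0)"
proof -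
  \<comment> \<open>The semigroup property, obtained from the switching lemma with equal generators,
    exhibits \<open>V\<close> itself as a switched value for every positive \<epsilon>.\<close>
  have V: "V = (LINT s:{0..}|lborel. (if s < \<epsilon> then P 0 s else P 0 \<epsilon> ** P 0 (s - \<epsilon>))
      *v (if s < \<epsilon> then g s else g s))" if "0 < \<epsilon>" for \<epsilon>
    unfolding V_def
  proof (rule set_lebesgue_integral_cong)
    show "\<forall>s. s \<in> {0..} \<longrightarrow> P 0 s *v g s = (if s < \<epsilon> then P 0 s else P 0 \<epsilon> ** P 0 (s - \<epsilon>))
      *v (if s < \<epsilon> then g s else g s)"
      using transition_function_switch[OF P P, of \<epsilon> P] P that by simp
  qed simp
  let ?W = "\<lambda>\<epsilon>. LINT s:{0..}|lborel. (if s < \<epsilon> then P' 0 s else P' 0 \<epsilon> ** P 0 (s - \<epsilon>))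
      *v (if s < \<epsilon> then g' s else g s)"
  let ?K = "\<lambda>\<epsilon>. LINT s:{\<epsilon>..}|lborel. P 0 (s - \<epsilon>) *v g s"
  have "((\<lambda>\<epsilon>. (?W \<epsilon> - ?K \<epsilon>) /\<^sub>R \<epsilon>) \<longlongrightarrow> g' 0 + A' *v V) (at_right 0)"
    unfolding V_def by (rule switched_value_quotient_tendsto[OF P P' C C' g g' cont(2)])
  moreover have "((\<lambda>\<epsilon>. (V - ?K \<epsilon>) /\<^sub>R \<epsilon>) \<longlongrightarrow> g 0 + A *v V) (at_right 0)"
  proof (rule Lim_transform_eventually)
    show "((\<lambda>\<epsilon>. ((LINT s:{0..}|lborel. (if s < \<epsilon> then P 0 s else P 0 \<epsilon> ** P 0 (s - \<epsilon>))
      *v (if s < \<epsilon> then g s else g s)) - ?K \<epsilon>) /\<^sub>R \<epsilon>) \<longlongrightarrow> g 0 + A *v V) (at_right 0)"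
      unfolding V_def by (rule switched_value_quotient_tendsto[OF P P C C g g cont(1)])
  qed (use V in \<open>auto intro: eventually_mono[OF eventually_at_right_less[of 0]]\<close>)
  ultimately have "((\<lambda>\<epsilon>. (?W \<epsilon> - ?K \<epsilon>) /\<^sub>R \<epsilon> - (V - ?K \<epsilon>) /\<^sub>R \<epsilon>)
      \<longlongrightarrow> (g' 0 + A' *v V) - (g 0 + A *v V)) (at_right 0)"
    by (rule tendsto_diff)
  then show ?thesis
    by (simp add: scaleR_diff_right[symmetric] del: scaleR_right.diff)
qed

section \<open>Running rewards\<close>

text \<open>Such an \<open>f\<close> is a Caratheodory function: rounding time down to a grid leaves
  countably many measurable slices, and continuity in time recovers the limit. Grid points to the
  left are allowed here, unlike for the chain, which is only right continuous. \<open>max 0\<close>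
  replaces negative times, about which nothing is assumed.\<close>

lemma time_continuous_jointly_measurable:
  fixes f :: "real \<Rightarrow> 'b \<Rightarrow> real"
  assumes meas: "\<And>t. 0 \<le> t \<Longrightarrow> f t \<in> borel_measurable \<mu>"
    and cont: "\<And>u. u \<in> space \<mu> \<Longrightarrow> continuous_on {0..} (\<lambda>t. f t u)"
  shows "(\<lambda>(s, u). f (max 0 s) u) \<in> borel_measurable (lborel \<Otimes>\<^sub>M \<mu>)"
proof -
  define \<nu> where "\<nu> = (\<lambda>(n::nat) (s::real). nat \<lfloor>real (Suc n) * max 0 s\<rfloor>)"
  define F where "F = (\<lambda>n (s :: real, u). f (real (\<nu> n s) / real (Suc n)) u)"
  have "F n \<in> borel_measurable (lborel \<Otimes>\<^sub>M \<mu>)" for n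
  proof -
    have [measurable]: "(\<lambda>x. \<nu> n (fst x)) \<in> measurable (lborel \<Otimes>\<^sub>M \<mu>) (count_space UNIV)"
      unfolding \<nu>_def by measurable
    have "f (real k / real (Suc n)) \<in> borel_measurable \<mu>" for k
      by (rule meas) simp
    note [measurable] = this
    have "(\<lambda>x. (\<lambda>k x. f (real k / real (Suc n)) (snd x)) (\<nu> n (fst x)) x)
        \<in> borel_measurable (lborel \<Otimes>\<^sub>M \<mu>)"
      by (rule measurable_compose_countable) measurable
    then show ?thesis
      by (simp add: F_def case_prod_beta)
  qed
  then show ?thesis
  proof (rule borel_measurable_LIMSEQ_real[rotated])
    fix x :: "real \<times> 'b" assume "x \<in> space (lborel \<Otimes>\<^sub>M \<mu>)"
    then obtain s u where x: "x = (s, u)" "u \<in> space \<mu>"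
      by (auto simp: space_pair_measure)
    have \<nu>: "max 0 s - inverse (real (Suc n)) \<le> real (\<nu> n s) / real (Suc n)"
      "real (\<nu> n s) / real (Suc n) \<le> max 0 s" for n
    proof -
      have "real (\<nu> n s) = of_int \<lfloor>real (Suc n) * max 0 s\<rfloor>"
        by (simp add: \<nu>_def del: of_nat_Suc)
      then have "real (Suc n) * max 0 s - 1 \<le> real (\<nu> n s)" "real (\<nu> n s) \<le> real (Suc n) * max 0 s"
        by linarith+
      from this[THEN divide_right_mono, of "real (Suc n)"]
      show "max 0 s - inverse (real (Suc n)) \<le> real (\<nu> n s) / real (Suc n)"
        "real (\<nu> n s) / real (Suc n) \<le> max 0 s"
        by (simp_all add: diff_divide_distrib inverse_eq_divide del: of_nat_Suc)
    qed
    have "(\<lambda>n. max 0 s - inverse (real (Suc n))) \<longlonglongrightarrow> max 0 s - 0"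
      by (intro tendsto_intros LIMSEQ_inverse_real_of_nat)
    then have "(\<lambda>n. real (\<nu> n s) / real (Suc n)) \<longlonglongrightarrow> max 0 s"
      by (intro tendsto_sandwich[of "\<lambda>n. max 0 s - inverse (real (Suc n))" "\<lambda>n. real (\<nu> n s) / real (Suc n)" _ "\<lambda>_. max 0 s"])
        (auto intro!: always_eventually \<nu> simp del: of_nat_Suc)
    then have "(\<lambda>n. f (real (\<nu> n s) / real (Suc n)) u) \<longlonglongrightarrow> f (max 0 s) u"
      by (rule continuous_on_tendsto_compose[OF cont[OF x(2)]]) auto
    then show "(\<lambda>n. F n x) \<longlonglongrightarrow> (case x of (s, u) \<Rightarrow> f (max 0 s) u)"
      by (simp add: x F_def)
  qed
qed

text \<open>\<open>F\<close> will be the supremum of |f| over states and actions plus \<delta>. It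
  enters only through monotonicity of \<open>nn_integral\<close>, so this supremum can be inserted
  as it stands, with infinite values allowed and without a proof that it is measurable.\<close>

lemma set_integrable_expectation:
  fixes f :: "real \<Rightarrow> 'b \<Rightarrow> real"
  assumes "prob_space \<mu>"
    and meas: "\<And>t. 0 \<le> t \<Longrightarrow> f t \<in> borel_measurable \<mu>"
    and cont: "\<And>u. u \<in> space \<mu> \<Longrightarrow> continuous_on {0..} (\<lambda>t. f t u)"
    and bound: "\<And>t u. 0 \<le> t \<Longrightarrow> u \<in> space \<mu> \<Longrightarrow> ennreal \<bar>f t u\<bar> \<le> F t"
    and F: "(\<integral>\<^sup>+t\<in>{0..}. F t \<partial>lborel) < \<infinity>"
  shows "set_integrable lborel {0..} (\<lambda>t. \<integral>u. f t u \<partial>\<mu>)"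
  unfolding set_integrable_def
proof (rule integrableI_bounded)
  interpret prob_space \<mu> by fact
  have "(\<lambda>t. \<integral>u. f (max 0 t) u \<partial>\<mu>) \<in> borel_measurable lborel"
    by (rule borel_measurable_lebesgue_integral[OF time_continuous_jointly_measurable[OF meas cont]])
  then have "(\<lambda>t. indicator {0..} t * (\<integral>u. f (max 0 t) u \<partial>\<mu>)) \<in> borel_measurable lborel"
    by measurable
  also have "(\<lambda>t. indicator {0..} t * (\<integral>u. f (max 0 t) u \<partial>\<mu>)) = (\<lambda>t. indicator {0..} t *\<^sub>R (\<integral>u. f t u \<partial>\<mu>))"
    by (auto simp: indicator_def fun_eq_iff)
  finally show "(\<lambda>t. indicator {0..} t *\<^sub>R (\<integral>u. f t u \<partial>\<mu>)) \<in> borel_measurable lborel" .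
  have "ennreal \<bar>\<integral>u. f t u \<partial>\<mu>\<bar> \<le> F t" if "0 \<le> t" for t
  proof -
    have "ennreal \<bar>\<integral>u. f t u \<partial>\<mu>\<bar> \<le> (\<integral>\<^sup>+u. ennreal \<bar>f t u\<bar> \<partial>\<mu>)"
    \<comment> \<open>At times where \<open>F t\<close> is infinite the integral over actions may
      fail to exist; its default value 0 obeys the bound as well.\<close>
    proof (cases "integrable \<mu> (f t)")
      case True
      then show ?thesis
        using integral_norm_bound_ennreal[OF True] by simp
    qed (simp add: not_integrable_integral_eq)
    also have "\<dots> \<le> (\<integral>\<^sup>+u. F t \<partial>\<mu>)"
      by (rule nn_integral_mono) (rule bound[OF that])
    finally show ?thesis
      by (simp add: emeasure_space_1)
  qed
  then have "(\<integral>\<^sup>+t. ennreal (norm (indicator {0..} t *\<^sub>R (\<integral>u. f t u \<partial>\<mu>))) \<partial>lborel)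
      \<le> (\<integral>\<^sup>+t\<in>{0..}. F t \<partial>lborel)"
    by (intro nn_integral_mono) (auto simp: indicator_def)
  with F show "(\<integral>\<^sup>+t. ennreal (norm (indicator {0..} t *\<^sub>R (\<integral>u. f t u \<partial>\<mu>))) \<partial>lborel) < \<infinity>"
    by (rule order_le_less_trans[rotated])
qed

text \<open>Dominated convergence with the constant \<open>B\<close>, which is integrable because
  \<mu> has mass one. The bound is confined to \<open>{0..T}\<close>, but continuity at 0 depends
  only on times below \<open>T\<close>.\<close>

lemma expectation_continuous_at_0:
  fixes f :: "real \<Rightarrow> 'b \<Rightarrow> real"
  assumes "prob_space \<mu>"
    and meas: "\<And>t. 0 \<le> t \<Longrightarrow> f t \<in> borel_measurable \<mu>"
    and cont: "\<And>u. u \<in> space \<mu> \<Longrightarrow> continuous_on {0..} (\<lambda>t. f t u)"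
    and "0 < T" and bound: "\<And>t u. t \<in> {0..T} \<Longrightarrow> u \<in> space \<mu> \<Longrightarrow> \<bar>f t u\<bar> \<le> B"
  shows "continuous (at 0 within {0..}) (\<lambda>t. \<integral>u. f t u \<partial>\<mu>)"
proof -
  interpret prob_space \<mu> by fact
  have "((\<lambda>t. \<integral>u. f t u \<partial>\<mu>) \<longlongrightarrow> (\<integral>u. f 0 u \<partial>\<mu>)) (at 0 within {0..T})"
    unfolding tendsto_at_iff_sequentially comp_def
  proof (intro allI impI)
    fix e :: "nat \<Rightarrow> real" assume e: "\<forall>i. e i \<in> {0..T} - {0}" and e0: "e \<longlonglongrightarrow> 0"
    show "(\<lambda>n. \<integral>u. f (e n) u \<partial>\<mu>) \<longlonglongrightarrow> (\<integral>u. f 0 u \<partial>\<mu>)"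
    proof (rule integral_dominated_convergence[where w = "\<lambda>_. B"])
      show "AE u in \<mu>. (\<lambda>n. f (e n) u) \<longlonglongrightarrow> f 0 u"
        by (intro AE_I2 continuous_on_tendsto_compose[OF cont e0]) (use e in auto)
    qed (use e meas bound in auto)
  qed
  moreover have "at 0 within {0..T} = at 0 within {0..}"
    using \<open>0 < T\<close> by (intro at_within_nhd[of 0 "{..<T}"]) auto
  ultimately show ?thesis
    by (simp add: continuous_within)
qed

text \<open>For transition matrices, whose entries are probabilities, this is a bound uniform in
  time, as dominated convergence requires. The constant counts the terms of a double sum in which
  each term is at most \<open>norm x\<close>.\<close>

lemma norm_matrix_vector_mult_le:
  fixes B :: "real^'n^'n"
  assumes "\<And>i j. \<bar>B $ i $ j\<bar> \<le> 1"
  shows "norm (B *v x) \<le> real CARD('n) * real CARD('n) * norm x"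
proof -
  have "norm (B *v x) \<le> (\<Sum>i\<in>UNIV. \<bar>(B *v x) $ i\<bar>)"
    by (rule norm_le_l1_cart)
  also have "\<dots> \<le> (\<Sum>i\<in>(UNIV::'n set). \<Sum>j\<in>(UNIV::'n set). norm x)"
  proof (rule sum_mono)
    fix i
    have "\<bar>(B *v x) $ i\<bar> \<le> (\<Sum>j\<in>UNIV. \<bar>B $ i $ j * x $ j\<bar>)"
      by (simp add: matrix_vector_mult_def sum_abs)
    also have "\<dots> \<le> (\<Sum>j\<in>(UNIV::'n set). norm x)"
    proof (rule sum_mono)
      fix j
      have "\<bar>B $ i $ j\<bar> * \<bar>x $ j\<bar> \<le> 1 * norm x"
        by (intro mult_mono assms component_le_norm_cart) auto
      then show "\<bar>B $ i $ j * x $ j\<bar> \<le> norm x"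
        by (simp add: abs_mult)
    qed
    finally show "\<bar>(B *v x) $ i\<bar> \<le> (\<Sum>j\<in>(UNIV::'n set). norm x)" .
  qed
  finally show ?thesis
    by simp
qed

section \<open>Gibbs variational principle\<close>

lemma space_leb [simp]: "space (leb U) = U"
  by (simp add: leb_def space_restrict_space)

lemma sets_leb: "sets (leb U) = sets (restrict_space borel U)"
  by (simp add: leb_def sets_restrict_space)

lemma finite_measure_leb:
  assumes "compact U"
  shows "finite_measure (leb U)"
proof (rule finite_measureI)
  have "U \<in> sets lborel"
    using assms by (simp add: borel_compact)
  then have "emeasure (leb U) (space (leb U)) = emeasure lborel U"
    by (simp add: leb_def emeasure_restrict_space space_restrict_space)
  then show "emeasure (leb U) (space (leb U)) \<noteq> \<infinity>"
    using emeasure_compact_finite[OF assms] by simp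
qed

lemma space_density_measure [simp]: "space (density_measure U \<rho>) = U"
  by (simp add: density_measure_def)

lemma sets_density_measure [simp]: "sets (density_measure U \<rho>) = sets (restrict_space borel U)"
  by (simp add: density_measure_def sets_leb)

lemma densitiesD:
  assumes "\<rho> \<in> densities U"
  shows "\<rho> \<in> borel_measurable (leb U)" "\<And>u. u \<in> U \<Longrightarrow> 0 \<le> \<rho> u"
    and "integrable (leb U) \<rho>" "(\<integral>u. \<rho> u \<partial>leb U) = 1"
proof -
  show meas: "\<rho> \<in> borel_measurable (leb U)" and nonneg: "\<And>u. u \<in> U \<Longrightarrow> 0 \<le> \<rho> u"
    using assms by (auto simp: densities_def)
  have one: "(\<integral>\<^sup>+u. ennreal (\<rho> u) \<partial>leb U) = 1"
    using assms by (simp add: densities_def)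
  then have norm: "(\<integral>\<^sup>+u. ennreal (norm (\<rho> u)) \<partial>leb U) = 1"
    using nonneg by (subst nn_integral_cong[where v = "\<lambda>u. ennreal (\<rho> u)"]) auto
  then show "integrable (leb U) \<rho>"
    by (intro integrableI_bounded meas) simp
  show "(\<integral>u. \<rho> u \<partial>leb U) = 1"
    using one nonneg meas by (subst integral_eq_nn_integral) auto
qed

lemma prob_space_density_measure:
  assumes "\<rho> \<in> densities U"
  shows "prob_space (density_measure U \<rho>)"
proof (rule prob_spaceI)
  have "emeasure (density_measure U \<rho>) (space (leb U)) = (\<integral>\<^sup>+u\<in>space (leb U). ennreal (\<rho> u) \<partial>leb U)"
    unfolding density_measure_def
    using densitiesD(1)[OF assms] sets.top[of "leb U"] by (intro emeasure_density) auto
  also have "\<dots> = (\<integral>\<^sup>+u. ennreal (\<rho> u) \<partial>leb U)"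
    by (intro nn_integral_cong) simp
  also have "\<dots> = 1"
    using assms by (simp add: densities_def)
  finally show "emeasure (density_measure U \<rho>) (space (density_measure U \<rho>)) = 1"
    by simp
qed

lemma integral_density_measure:
  assumes "\<rho> \<in> densities U" "h \<in> borel_measurable (leb U)"
  shows "(\<integral>u. h u \<partial>density_measure U \<rho>) = (\<integral>u. h u * \<rho> u \<partial>leb U)"
  unfolding density_measure_def
  using densitiesD(1,2)[OF assms(1)] assms(2) by (subst integral_density) (auto simp: mult.commute)

text \<open>The Radon-Nikodym derivative chosen in \<open>measure_entropy\<close> agrees with \<rho>
  only almost everywhere, and the two integrals that define the entropy do not see the difference.
  Finiteness of \<open>leb U\<close> gives the uniqueness of the derivative.\<close>

lemma measure_entropy_density_measure:
  assumes "compact U" "\<rho> \<in> densities U"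
  shows "measure_entropy U (density_measure U \<rho>) = diff_entropy U \<rho>"
proof -
  interpret finite_measure "leb U"
    by (rule finite_measure_leb) fact
  note [measurable] = densitiesD(1)[OF assms(2)]
  have "AE u in leb U. ennreal (\<rho> u) = RN_deriv (leb U) (density_measure U \<rho>) u"
    by (rule RN_deriv_unique) (auto simp: density_measure_def)
  then have "AE u in leb U. enn2real (RN_deriv (leb U) (density_measure U \<rho>) u) = \<rho> u"
    using AE_space
  proof eventually_elim
    case (elim u)
    then show ?case
      using densitiesD(2)[OF assms(2), of u] by (metis enn2real_ennreal space_leb)
  qed
  then have "(\<integral>\<^sup>+u. F (enn2real (RN_deriv (leb U) (density_measure U \<rho>) u)) \<partial>leb U)
      = (\<integral>\<^sup>+u. F (\<rho> u) \<partial>leb U)" for F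
    by (intro nn_integral_cong_AE) (auto elim: eventually_mono)
  note this[of "\<lambda>x. ennreal (- (ln x * x))"] this[of "\<lambda>x. ennreal (ln x * x)"]
  then show ?thesis
    by (simp add: measure_entropy_def diff_entropy_def)
qed

text \<open>This is \<open>ln y \<le> y - 1\<close> at \<open>y = 1 / x\<close>. The sharp constant
  is 1/e, but any constant is integrable over the finite measure \<open>leb U\<close>.\<close>

lemma neg_x_ln_x_le_1:
  fixes x :: real
  assumes "0 \<le> x"
  shows "- (ln x * x) \<le> 1"
proof (cases "x = 0")
  case False
  then have "ln (1 / x) \<le> 1 / x - 1"
    using assms by (intro ln_le_minus_one) simp
  then have "- ln x * x \<le> (1 / x - 1) * x"
    using assms False by (intro mult_right_mono) (auto simp: ln_div)
  also have "\<dots> = 1 - x"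
    using False by (simp add: left_diff_distrib)
  finally show ?thesis
    using assms by simp
qed simp

text \<open>The negative part of \<open>ln (\<rho> u) * \<rho> u\<close> is at most 1, so its
  integral \<open>a\<close> is at most the Lebesgue measure of \<open>U\<close>. The entropy is thus
  never a difference of two infinities, and it equals -\<infinity> exactly when the integral
  \<open>b\<close> of the positive part diverges.\<close>

lemma diff_entropy_finite:
  assumes "compact U" "\<rho> \<in> densities U"
  shows "diff_entropy U \<rho> > -\<infinity> \<longleftrightarrow> integrable (leb U) (\<lambda>u. ln (\<rho> u) * \<rho> u)"
    and "diff_entropy U \<rho> > -\<infinity> \<Longrightarrow> real_of_ereal (diff_entropy U \<rho>) = - (\<integral>u. ln (\<rho> u) * \<rho> u \<partial>leb U)"
proof -
  interpret finite_measure "leb U"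
    by (rule finite_measure_leb) fact
  note [measurable] = densitiesD(1)[OF assms(2)]
  define a where "a = (\<integral>\<^sup>+u. ennreal (- (ln (\<rho> u) * \<rho> u)) \<partial>leb U)"
  define b where "b = (\<integral>\<^sup>+u. ennreal (ln (\<rho> u) * \<rho> u) \<partial>leb U)"
  have "a \<le> (\<integral>\<^sup>+u. 1 \<partial>leb U)"
    unfolding a_def
    by (intro nn_integral_mono) (use densitiesD(2)[OF assms(2)] neg_x_ln_x_le_1 in auto)
  then have a: "a \<noteq> \<infinity>"
    using emeasure_finite[of "space (leb U)"] by (auto simp: top_unique)
  have H: "diff_entropy U \<rho> = enn2ereal a - enn2ereal b"
    by (simp add: diff_entropy_def a_def b_def)
  obtain a' where a': "a = ennreal a'" "0 \<le> a'"
    using a by (cases a) auto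
  have "diff_entropy U \<rho> > -\<infinity> \<longleftrightarrow> b \<noteq> \<infinity>"
    unfolding H a' by (cases b) (auto simp: a')
  also have "b \<noteq> \<infinity> \<longleftrightarrow> integrable (leb U) (\<lambda>u. ln (\<rho> u) * \<rho> u)"
    using a by (simp add: real_integrable_def a_def b_def)
  finally show iff: "diff_entropy U \<rho> > -\<infinity> \<longleftrightarrow> integrable (leb U) (\<lambda>u. ln (\<rho> u) * \<rho> u)" .
  assume "diff_entropy U \<rho> > -\<infinity>"
  with iff have int: "integrable (leb U) (\<lambda>u. ln (\<rho> u) * \<rho> u)"
    by simp
  then have "b \<noteq> \<infinity>"
    by (simp add: real_integrable_def b_def)
  then obtain b' where b': "b = ennreal b'" "0 \<le> b'"
    by (cases b) auto
  show "real_of_ereal (diff_entropy U \<rho>) = - (\<integral>u. ln (\<rho> u) * \<rho> u \<partial>leb U)"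
    unfolding real_lebesgue_integral_def[OF int] a_def[symmetric] b_def[symmetric] H a' b'
    using a'(2) b'(2) by simp
qed

text \<open>The Kullback-Leibler divergence of \<open>p\<close> from \<open>r\<close> is
  nonnegative, and zero only for equal densities. Since both masses agree, adding
  \<open>r u - p u\<close> to its integrand leaves the integral unchanged and makes the integrand
  pointwise nonnegative.\<close>

lemma gibbs_inequality:
  fixes p r :: "'a \<Rightarrow> real"
  assumes p: "integrable N p" and r: "integrable N r" and eq: "(\<integral>u. p u \<partial>N) = (\<integral>u. r u \<partial>N)"
    and p0: "\<And>u. u \<in> space N \<Longrightarrow> 0 \<le> p u" and r0: "\<And>u. u \<in> space N \<Longrightarrow> 0 < r u"
    and int: "integrable N (\<lambda>u. ln (p u) * p u)" "integrable N (\<lambda>u. ln (r u) * p u)"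
  shows "(\<integral>u. ln (r u) * p u \<partial>N) \<le> (\<integral>u. ln (p u) * p u \<partial>N)"
    and "(\<integral>u. ln (r u) * p u \<partial>N) = (\<integral>u. ln (p u) * p u \<partial>N) \<Longrightarrow> AE u in N. p u = r u"
proof -
  \<comment> \<open>\<open>k \<ge> 0\<close> is \<open>ln x \<le> x - 1\<close> at \<open>x = r u / p u\<close>.\<close>
  define k where "k = (\<lambda>u. (r u - p u) - (ln (r u) * p u - ln (p u) * p u))"
  have k_int: "integrable N k"
    unfolding k_def by (intro Bochner_Integration.integrable_diff p r int)
  have k_eq: "(\<integral>u. k u \<partial>N) = (\<integral>u. ln (p u) * p u \<partial>N) - (\<integral>u. ln (r u) * p u \<partial>N)"
    unfolding k_def using p r int eq by simp
  have k_div: "k u = p u * ((r u / p u - 1) - ln (r u / p u))" "0 < r u / p u" if "u \<in> space N" "p u \<noteq> 0" for u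
    using that p0[of u] r0[of u] by (auto simp: k_def ln_div field_simps)
  have k0: "0 \<le> k u" if "u \<in> space N" for u
  proof (cases "p u = 0")
    case False
    then show ?thesis
      using k_div[OF that False] ln_le_minus_one[of "r u / p u"] p0[OF that] by simp
  qed (use r0[OF that] in \<open>simp add: k_def\<close>)
  then have "0 \<le> (\<integral>u. k u \<partial>N)"
    by (rule Bochner_Integration.integral_nonneg)
  then show "(\<integral>u. ln (r u) * p u \<partial>N) \<le> (\<integral>u. ln (p u) * p u \<partial>N)"
    using k_eq by simp
  assume "(\<integral>u. ln (r u) * p u \<partial>N) = (\<integral>u. ln (p u) * p u \<partial>N)"
  then have "AE u in N. k u = 0"
    using k_eq k0 by (subst integral_nonneg_eq_0_iff_AE[OF k_int, symmetric]) auto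
  then show "AE u in N. p u = r u"
    using AE_space
  proof eventually_elim
    case (elim u)
    \<comment> \<open>Where \<open>p u = 0\<close>, the value \<open>k u\<close> is
      \<open>r u\<close>, which is positive; so \<open>k u = 0\<close> rules this case out and
      permits division by \<open>p u\<close>.\<close>
    have "p u \<noteq> 0"
      using elim r0[of u] by (auto simp: k_def)
    then have "ln (r u / p u) = r u / p u - 1"
      using k_div(1)[of u] elim by simp
    then have "r u / p u = 1"
      using ln_eq_minus_one k_div(2)[of u] elim \<open>p u \<noteq> 0\<close> by blast
    then show ?case
      using \<open>p u \<noteq> 0\<close> by simp
  qed
qed

text \<open>By construction \<open>h u = lam * (ln (\<Gamma> u) + ln Z)\<close> with the normalizing
  integral \<open>Z\<close>. Hence \<open>E \<rho>\<close> is \<open>lam * ln Z\<close> minus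
  \<open>lam\<close> times the Kullback-Leibler divergence of \<rho> from \<Gamma>, and maximality
  and uniqueness are the two halves of \<open>gibbs_inequality\<close>. The bound \<open>B\<close>
  makes \<open>w\<close> and all \<open>h u * \<rho> u\<close> integrable. Uniqueness concerns the
  measures because a density is determined only almost everywhere.\<close>

lemma gibbs_variational_principle:
  fixes U :: "(real^'l) set"
  assumes U: "compact U" "emeasure lborel U > 0"
    and h: "h \<in> borel_measurable (leb U)" and B: "\<And>u. u \<in> U \<Longrightarrow> \<bar>h u\<bar> \<le> B" and "0 < lam"
  defines "\<Gamma> \<equiv> \<lambda>u. exp (1 / lam * h u) / (\<integral>v. exp (1 / lam * h v) \<partial>leb U)"
    and "E \<equiv> \<lambda>\<rho>. (\<integral>u. h u \<partial>density_measure U \<rho>) + lam * real_of_ereal (diff_entropy U \<rho>)"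
  shows "\<Gamma> \<in> densities U" "diff_entropy U \<Gamma> > -\<infinity>"
    and "\<And>\<rho>. \<rho> \<in> densities U \<Longrightarrow> diff_entropy U \<rho> > -\<infinity> \<Longrightarrow> E \<rho> \<le> E \<Gamma>"
    and "\<And>\<rho>. \<rho> \<in> densities U \<Longrightarrow> diff_entropy U \<rho> > -\<infinity> \<Longrightarrow> E \<Gamma> \<le> E \<rho> \<Longrightarrow>
      density_measure U \<Gamma> = density_measure U \<rho>"
proof -
  interpret finite_measure "leb U"
    by (rule finite_measure_leb) fact
  define w where "w = (\<lambda>u. exp (1 / lam * h u))"
  define Z where "Z = (\<integral>v. w v \<partial>leb U)"
  note [measurable] = h
  have w_int: "integrable (leb U) w"
    unfolding w_def
    by (rule integrable_const_bound[where B = "exp (1 / lam * B)"])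
      (use B \<open>0 < lam\<close> in \<open>auto intro!: AE_I2 simp: divide_right_mono abs_le_iff\<close>)
  have "0 \<le> Z"
    unfolding Z_def by (rule Bochner_Integration.integral_nonneg) (simp add: w_def)
  \<comment> \<open>Here the positive Lebesgue measure of \<open>U\<close> enters: \<open>w\<close>
    is strictly positive, so \<open>Z = 0\<close> would make \<open>U\<close> a null set.\<close>
  moreover have "Z \<noteq> 0"
  proof
    assume "Z = 0"
    then have "AE u in leb U. w u = 0"
      using w_int by (subst integral_nonneg_eq_0_iff_AE[symmetric]) (auto simp: Z_def w_def)
    then have "AE u in leb U. False"
      by (simp add: w_def)
    then have "emeasure (leb U) (space (leb U)) = 0"
      using AE_iff_measurable[of "space (leb U)" "leb U" "\<lambda>_. False"] sets.top[of "leb U"] by auto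
    then show False
      using U by (simp add: leb_def emeasure_restrict_space borel_compact)
  qed
  ultimately have Z: "0 < Z"
    by simp
  have \<Gamma>: "\<Gamma> = (\<lambda>u. w u / Z)"
    by (simp add: \<Gamma>_def w_def Z_def)
  have \<Gamma>_int: "integrable (leb U) \<Gamma>"
    unfolding \<Gamma> using w_int by simp
  have \<Gamma>_pos: "0 < \<Gamma> u" for u
    unfolding \<Gamma> using Z by (simp add: w_def)
  have \<Gamma>_one: "(\<integral>u. \<Gamma> u \<partial>leb U) = 1"
    unfolding \<Gamma> using Z by (simp add: Z_def)
  show \<Gamma>_dens: "\<Gamma> \<in> densities U"
    unfolding densities_def
    using nn_integral_eq_integral[OF \<Gamma>_int] \<Gamma>_one \<Gamma>_pos \<Gamma>_int by (auto intro: less_imp_le)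
  have ln_\<Gamma>: "ln (\<Gamma> u) = h u / lam - ln Z" for u
    unfolding \<Gamma> using Z by (simp add: ln_div w_def)
  have h\<rho>: "integrable (leb U) (\<lambda>u. h u * \<rho> u)" if "\<rho> \<in> densities U" for \<rho>
  proof (rule Bochner_Integration.integrable_bound)
    show "integrable (leb U) (\<lambda>u. B * \<rho> u)"
      using densitiesD(3)[OF that] by simp
    show "(\<lambda>u. h u * \<rho> u) \<in> borel_measurable (leb U)"
      using densitiesD(1)[OF that] by measurable
    show "AE u in leb U. norm (h u * \<rho> u) \<le> norm (B * \<rho> u)"
      using B by (intro AE_I2) (fastforce simp: abs_mult intro!: mult_right_mono)
  qed
  have ln\<Gamma>\<rho>: "integrable (leb U) (\<lambda>u. ln (\<Gamma> u) * \<rho> u)"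
    "(\<integral>u. h u * \<rho> u \<partial>leb U) = lam * (\<integral>u. ln (\<Gamma> u) * \<rho> u \<partial>leb U) + lam * ln Z"
    if "\<rho> \<in> densities U" for \<rho>
  proof -
    have *: "(\<lambda>u. ln (\<Gamma> u) * \<rho> u) = (\<lambda>u. (h u * \<rho> u) / lam - ln Z * \<rho> u)"
      by (simp add: ln_\<Gamma> algebra_simps)
    show "integrable (leb U) (\<lambda>u. ln (\<Gamma> u) * \<rho> u)"
      unfolding * using h\<rho>[OF that] densitiesD(3)[OF that] by simp
    show "(\<integral>u. h u * \<rho> u \<partial>leb U) = lam * (\<integral>u. ln (\<Gamma> u) * \<rho> u \<partial>leb U) + lam * ln Z"
      unfolding * using h\<rho>[OF that] densitiesD(3,4)[OF that] \<open>0 < lam\<close>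
      by (simp add: right_diff_distrib)
  qed
  show \<Gamma>_ent: "diff_entropy U \<Gamma> > -\<infinity>"
    using diff_entropy_finite(1)[OF U(1) \<Gamma>_dens] ln\<Gamma>\<rho>(1)[OF \<Gamma>_dens] by simp
  have E: "E \<rho> = lam * ((\<integral>u. ln (\<Gamma> u) * \<rho> u \<partial>leb U) - (\<integral>u. ln (\<rho> u) * \<rho> u \<partial>leb U)) + lam * ln Z"
    if "\<rho> \<in> densities U" "diff_entropy U \<rho> > -\<infinity>" for \<rho>
    by (simp add: E_def integral_density_measure[OF that(1) h] ln\<Gamma>\<rho>(2)[OF that(1)]
        diff_entropy_finite(2)[OF U(1) that] right_diff_distrib)
  have E\<Gamma>: "E \<Gamma> = lam * ln Z"
    using E[OF \<Gamma>_dens \<Gamma>_ent] by simp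
  fix \<rho> assume \<rho>: "\<rho> \<in> densities U" "diff_entropy U \<rho> > -\<infinity>"
  have int: "integrable (leb U) (\<lambda>u. ln (\<rho> u) * \<rho> u)"
    using diff_entropy_finite(1)[OF U(1) \<rho>(1)] \<rho>(2) by simp
  note gibbs_ineq = gibbs_inequality[OF densitiesD(3)[OF \<rho>(1)] \<Gamma>_int, unfolded densitiesD(4)[OF \<rho>(1)] \<Gamma>_one,
      OF refl densitiesD(2)[OF \<rho>(1)] \<Gamma>_pos int ln\<Gamma>\<rho>(1)[OF \<rho>(1)], unfolded space_leb]
  have le: "(\<integral>u. ln (\<Gamma> u) * \<rho> u \<partial>leb U) \<le> (\<integral>u. ln (\<rho> u) * \<rho> u \<partial>leb U)"
    by (rule gibbs_ineq(1))
  then show "E \<rho> \<le> E \<Gamma>"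
    unfolding E[OF \<rho>] E\<Gamma> using \<open>0 < lam\<close> by (simp add: mult_le_0_iff)
  assume "E \<Gamma> \<le> E \<rho>"
  then have "(\<integral>u. ln (\<Gamma> u) * \<rho> u \<partial>leb U) = (\<integral>u. ln (\<rho> u) * \<rho> u \<partial>leb U)"
    unfolding E[OF \<rho>] E\<Gamma> using \<open>0 < lam\<close> le by (simp add: zero_le_mult_iff)
  then have "AE u in leb U. \<rho> u = \<Gamma> u"
    by (rule gibbs_ineq(2)[rotated])
  then show "density_measure U \<Gamma> = density_measure U \<rho>"
    unfolding density_measure_def
    using densitiesD(1)[OF \<Gamma>_dens] densitiesD(1)[OF \<rho>(1)]
    by (intro density_cong) (auto elim: eventually_mono)
qed

section \<open>The equilibrium characterization\<close>

lemma vec_eq_sum_axis: "x = (\<Sum>j\<in>UNIV. (x $ j) *\<^sub>R axis j (1 :: real))"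
  using basis_expansion[of x] by (simp add: scalar_mult_eq_scaleR)

lemma set_integrable_vec:
  fixes F :: "'a \<Rightarrow> real^'n"
  assumes "\<And>j. set_integrable M S (\<lambda>s. F s $ j)"
  shows "set_integrable M S F"
proof -
  have "(\<lambda>s. indicator S s *\<^sub>R F s) = (\<lambda>s. \<Sum>j\<in>UNIV. (indicator S s *\<^sub>R F s $ j) *\<^sub>R axis j (1 :: real))"
    using vec_eq_sum_axis[of "indicator S s *\<^sub>R F s" for s] by (simp add: fun_eq_iff)
  then show ?thesis
    using assms by (simp only: set_integrable_def Bochner_Integration.integrable_sum integrable_scaleR_left)
qed

lemma set_integral_vec_nth:
  fixes F :: "'a \<Rightarrow> real^'n"
  assumes "set_integrable M S F"
  shows "(LINT s:S|M. F s) $ j = (LINT s:S|M. F s $ j)"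
  unfolding set_lebesgue_integral_def
  using integral_bounded_linear[OF bounded_linear_vec_nth assms[unfolded set_integrable_def], of j]
  by simp

lemma set_integrable_if_less:
  fixes g g' :: "real \<Rightarrow> real^'n"
  assumes "set_integrable lborel {0..} g" "set_integrable lborel {0..} g'" "0 < \<epsilon>"
  shows "set_integrable lborel {0..} (\<lambda>s. if s < \<epsilon> then g' s else g s)"
proof -
  let ?h = "\<lambda>s. if s < \<epsilon> then g' s else g s"
  have "set_integrable lborel {0..<\<epsilon>} g'" "set_integrable lborel {\<epsilon>..} g"
    by (rule set_integrable_subset[OF assms(2)] set_integrable_subset[OF assms(1)]; use \<open>0 < \<epsilon>\<close> in auto)+
  moreover have "set_integrable lborel {0..<\<epsilon>} g' = set_integrable lborel {0..<\<epsilon>} ?h"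
    "set_integrable lborel {\<epsilon>..} g = set_integrable lborel {\<epsilon>..} ?h"
    by (rule set_integrable_cong; auto)+
  ultimately have "set_integrable lborel ({0..<\<epsilon>} \<union> {\<epsilon>..}) ?h"
    by (intro set_integrable_Un) auto
  then show ?thesis
    using \<open>0 < \<epsilon>\<close> by (simp add: ivl_disj_un)
qed

section \<open>The control problem, its value and its Hamiltonian\<close>

locale relaxed_control_problem =
  fixes U :: "(real^'l) set"
    and q :: "real^'l \<Rightarrow> real^'d^'d"
    and f :: "real \<Rightarrow> 'd \<Rightarrow> real^'l \<Rightarrow> real"
    and \<delta> :: "real \<Rightarrow> real"
    and lam :: real
    and M :: "(real \<Rightarrow> 'd \<Rightarrow> (real^'l) measure) \<Rightarrow> 'd \<Rightarrow> 'w measure"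
    and X :: "(real \<Rightarrow> 'd \<Rightarrow> (real^'l) measure) \<Rightarrow> 'd \<Rightarrow> real \<Rightarrow> 'w \<Rightarrow> 'd"
  assumes compact_U: "compact U" and U_pos: "emeasure lborel U > 0"
    and q_meas: "\<And>i j. (\<lambda>u. q u $ i $ j) \<in> borel_measurable (restrict_space borel U)"
    and q_bdd: "bounded (q ` U)"
    and \<delta>_range: "\<And>t. t \<ge> 0 \<Longrightarrow> 0 \<le> \<delta> t \<and> \<delta> t \<le> 1"
    and \<delta>_0: "\<delta> 0 = 1" and \<delta>_cont: "continuous_on {0..} \<delta>"
    and f_meas: "\<And>t i. t \<ge> 0 \<Longrightarrow> (\<lambda>u. f t i u) \<in> borel_measurable (restrict_space borel U)"
    and f_cont: "\<And>i u. u \<in> U \<Longrightarrow> continuous_on {0..} (\<lambda>t. f t i u)"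
    and f_bdd: "\<exists>T>0. \<exists>B. \<forall>t\<in>{0..T}. \<forall>i. \<forall>u\<in>U. \<bar>f t i u\<bar> \<le> B"
    and f_\<delta>_int: "(\<integral>\<^sup>+s\<in>{0..}. ((SUP i. SUP u\<in>U. ennreal \<bar>f s i u\<bar>) + ennreal (\<delta> s)) \<partial>lborel) < \<infinity>"
    and chain: "\<And>\<pi> i. \<pi> \<in> regular_controls U \<Longrightarrow>
           markov_chain (M (\<lambda>t. \<pi>) i) (X (\<lambda>t. \<pi>) i) (\<lambda>t. controlled_generator q \<pi>) i"
    and chain_switch: "\<And>\<pi> \<pi>' \<epsilon> i. \<pi> \<in> regular_controls U \<Longrightarrow> \<pi>' \<in> regular_controls U \<Longrightarrow> \<epsilon> > 0 \<Longrightarrow>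
           markov_chain (M (switch \<epsilon> \<pi>' \<pi>) i) (X (switch \<epsilon> \<pi>' \<pi>) i)
             (\<lambda>t. controlled_generator q (switch \<epsilon> \<pi>' \<pi> t)) i"
    and lam_pos: "lam > 0"
begin

abbreviation control_entropy :: "(real^'l) measure \<Rightarrow> real" where
  "control_entropy \<mu> \<equiv> real_of_ereal (measure_entropy U \<mu>)"

abbreviation value_of :: "(real \<Rightarrow> 'd \<Rightarrow> (real^'l) measure) \<Rightarrow> real^'d" where
  "value_of \<equiv> value_fn U f \<delta> lam M X"

text \<open>Collecting all states into one vector makes the value the time integral of transition
  matrix times \<open>reward_rate\<close>.\<close>

definition reward_rate :: "('d \<Rightarrow> (real^'l) measure) \<Rightarrow> real \<Rightarrow> real^'d" where
  "reward_rate \<pi> s = (\<chi> j. mean_reward f (\<pi> j) s j + lam * \<delta> s * control_entropy (\<pi> j))"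

text \<open>The weight of the entropy is \<open>lam\<close> without a discount factor because the
  Hamiltonian describes time 0, where \<open>\<delta> 0 = 1\<close>.\<close>

definition hamiltonian :: "real^'d \<Rightarrow> 'd \<Rightarrow> (real^'l) measure \<Rightarrow> real" where
  "hamiltonian y i \<mu> = (\<integral>u. f 0 i u + q u $ i \<bullet> y \<partial>\<mu>) + lam * control_entropy \<mu>"

lemma regular_control_density:
  assumes "\<pi> \<in> regular_controls U"
  obtains \<rho> where "\<rho> \<in> densities U" "\<pi> j = density_measure U \<rho>" "diff_entropy U \<rho> > -\<infinity>"
  using assms unfolding regular_controls_def by blast

lemma regular_control_measure:
  assumes "\<pi> \<in> regular_controls U"
  shows "prob_space (\<pi> j)" "space (\<pi> j) = U"
    "\<And>g :: real^'l \<Rightarrow> real. g \<in> borel_measurable (restrict_space borel U) \<Longrightarrow> g \<in> borel_measurable (\<pi> j)"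
proof -
  have "\<pi> j \<in> prob_measures U"
    using assms by (simp add: regular_controls_def relaxed_controls_def)
  then have sets: "sets (\<pi> j) = sets (restrict_space borel U)" and "prob_space (\<pi> j)"
    by (auto simp: prob_measures_def)
  then show "prob_space (\<pi> j)" by simp
  show "space (\<pi> j) = U"
    using sets_eq_imp_space_eq[OF sets] by (simp add: space_restrict_space)
  show "g \<in> borel_measurable (\<pi> j)" if "g \<in> borel_measurable (restrict_space borel U)" for g :: "real^'l \<Rightarrow> real"
    using that measurable_cong_sets[OF sets refl] by blast
qed

lemma reward_rate_integrable:
  assumes \<pi>: "\<pi> \<in> regular_controls U"
  shows "set_integrable lborel {0..} (reward_rate \<pi>)"
proof (rule set_integrable_vec)
  fix j
  interpret prob_space "\<pi> j"
    by (rule regular_control_measure[OF \<pi>])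
  have "set_integrable lborel {0..} (\<lambda>t. \<integral>u. f t j u \<partial>\<pi> j)"
  proof (rule set_integrable_expectation[OF prob_space_axioms _ _ _ f_\<delta>_int])
    fix t :: real and u assume "u \<in> space (\<pi> j)"
    then have "ennreal \<bar>f t j u\<bar> \<le> (SUP i. SUP u\<in>U. ennreal \<bar>f t i u\<bar>)"
      using regular_control_measure(2)[OF \<pi>] by (auto intro!: SUP_upper2)
    then show "ennreal \<bar>f t j u\<bar> \<le> (SUP i. SUP u\<in>U. ennreal \<bar>f t i u\<bar>) + ennreal (\<delta> t)"
      by (rule add_increasing2[OF zero_le])
  next
    show "f t j \<in> borel_measurable (\<pi> j)" if "0 \<le> t" for t
      by (rule regular_control_measure(3)[OF \<pi> f_meas[OF that]])
  qed (simp add: f_cont regular_control_measure(2)[OF \<pi>])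
  \<comment> \<open>Viewing \<delta> as an integrand that is constant in \<open>u\<close> lets the
    same lemma and the same majorant yield its integrability.\<close>
  moreover have "set_integrable lborel {0..} (\<lambda>t. \<integral>u. \<delta> t \<partial>\<pi> j)"
  proof (rule set_integrable_expectation[OF prob_space_axioms _ _ _ f_\<delta>_int])
    show "ennreal \<bar>\<delta> t\<bar> \<le> (SUP i. SUP u\<in>U. ennreal \<bar>f t i u\<bar>) + ennreal (\<delta> t)" if "0 \<le> t" for t
      using \<delta>_range[OF that] add_increasing[OF zero_le order_refl] by simp
  qed (use \<delta>_cont in auto)
  then have "set_integrable lborel {0..} (\<lambda>t. lam * control_entropy (\<pi> j) * \<delta> t)"
    by (simp add: prob_space)
  ultimately have "set_integrable lborel {0..} (\<lambda>t. (\<integral>u. f t j u \<partial>\<pi> j) + lam * control_entropy (\<pi> j) * \<delta> t)"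
    by (rule set_integral_add)
  then show "set_integrable lborel {0..} (\<lambda>s. reward_rate \<pi> s $ j)"
    by (simp add: reward_rate_def mean_reward_def mult_ac)
qed

lemma reward_rate_continuous:
  assumes \<pi>: "\<pi> \<in> regular_controls U"
  shows "continuous (at 0 within {0..}) (reward_rate \<pi>)"
  unfolding continuous_within
proof (rule vec_tendstoI)
  fix j
  obtain T B where TB: "0 < T" "\<And>t u. t \<in> {0..T} \<Longrightarrow> u \<in> U \<Longrightarrow> \<bar>f t j u\<bar> \<le> B"
    using f_bdd by blast
  have "continuous (at 0 within {0..}) (\<lambda>t. \<integral>u. f t j u \<partial>\<pi> j)"
  proof (rule expectation_continuous_at_0[where B = B, OF regular_control_measure(1)[OF \<pi>] _ _ TB(1)])
    show "f t j \<in> borel_measurable (\<pi> j)" if "0 \<le> t" for t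
      by (rule regular_control_measure(3)[OF \<pi> f_meas[OF that]])
  qed (simp_all add: f_cont TB(2) regular_control_measure(2)[OF \<pi>])
  moreover have "continuous (at 0 within {0..}) \<delta>"
    using \<delta>_cont by (simp add: continuous_on_eq_continuous_within)
  ultimately show "((\<lambda>s. reward_rate \<pi> s $ j) \<longlongrightarrow> reward_rate \<pi> 0 $ j) (at 0 within {0..})"
    unfolding reward_rate_def mean_reward_def continuous_within
    by (simp, intro tendsto_intros)
qed

text \<open>The Markov property of each chain supplies a transition function that may depend on the
  initial state. The generator does not depend on it, so by uniqueness one of them, for the
  arbitrary state \<open>i0\<close>, describes all initial states. Its entries are then
  probabilities, whence the bound.\<close>

lemma regular_control_transition:
  assumes \<pi>: "\<pi> \<in> regular_controls U"
  obtains P where "transition_function (\<lambda>_. controlled_generator q \<pi>) P"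
    and "\<And>i j t. 0 \<le> t \<Longrightarrow> measure (M (\<lambda>t. \<pi>) i) {\<omega> \<in> space (M (\<lambda>t. \<pi>) i). X (\<lambda>t. \<pi>) i t \<omega> = j} = P 0 t $ i $ j"
    and "\<And>s x. 0 \<le> s \<Longrightarrow> norm (P 0 s *v x) \<le> real CARD('d) * real CARD('d) * norm x"
proof -
  have "\<exists>P. transition_function (\<lambda>_. controlled_generator q \<pi>) P \<and>
      (\<forall>j t. 0 \<le> t \<longrightarrow> measure (M (\<lambda>t. \<pi>) i) {\<omega> \<in> space (M (\<lambda>t. \<pi>) i). X (\<lambda>t. \<pi>) i t \<omega> = j} = P 0 t $ i $ j)" for i
  proof (rule markov_chain_law[OF chain[OF \<pi>, of i]])
    fix P
    assume "transition_function (\<lambda>_. controlled_generator q \<pi>) P"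
      and "\<And>t j. 0 \<le> t \<Longrightarrow>
        measure (M (\<lambda>t. \<pi>) i) {\<omega> \<in> space (M (\<lambda>t. \<pi>) i). X (\<lambda>t. \<pi>) i t \<omega> = j} = P 0 t $ i $ j"
    then show ?thesis
      by (intro exI[of _ P]) simp
  qed
  then have "\<exists>P. \<forall>i. transition_function (\<lambda>_. controlled_generator q \<pi>) (P i) \<and>
      (\<forall>j t. 0 \<le> t \<longrightarrow> measure (M (\<lambda>t. \<pi>) i) {\<omega> \<in> space (M (\<lambda>t. \<pi>) i). X (\<lambda>t. \<pi>) i t \<omega> = j} = P i 0 t $ i $ j)"
    by (intro choice allI)
  then obtain P where Q: "\<forall>i. transition_function (\<lambda>_. controlled_generator q \<pi>) (P i) \<and>
      (\<forall>j t. 0 \<le> t \<longrightarrow> measure (M (\<lambda>t. \<pi>) i) {\<omega> \<in> space (M (\<lambda>t. \<pi>) i). X (\<lambda>t. \<pi>) i t \<omega> = j} = P i 0 t $ i $ j)"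
    by (rule exE)
  have P: "transition_function (\<lambda>_. controlled_generator q \<pi>) (P i)" for i
    using Q by simp
  have law: "measure (M (\<lambda>t. \<pi>) i) {\<omega> \<in> space (M (\<lambda>t. \<pi>) i). X (\<lambda>t. \<pi>) i t \<omega> = j} = P i 0 t $ i $ j"
    if "0 \<le> t" for i j t
    using Q that by simp
  define i0 :: 'd where "i0 = undefined"
  have law': "measure (M (\<lambda>t. \<pi>) i) {\<omega> \<in> space (M (\<lambda>t. \<pi>) i). X (\<lambda>t. \<pi>) i t \<omega> = j} = P i0 0 t $ i $ j"
    if "0 \<le> t" for i j t
    using law[OF that, of i j] transition_function_unique[OF P P that, of i i0] by simp
  have "\<bar>P i0 0 t $ i $ j\<bar> \<le> 1" if "0 \<le> t" for t i j
  proof -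
    interpret prob_space "M (\<lambda>t. \<pi>) i"
      using chain[OF \<pi>, of i] by (simp add: markov_chain_def)
    show ?thesis
      unfolding law'[OF that, symmetric] by simp
  qed
  then show thesis
    by (intro that[of "P i0", OF P law'] norm_matrix_vector_mult_le) auto
qed

text \<open>Row \<open>i\<close> of \<open>R s\<close> is the law at time \<open>s\<close> of the
  chain started in \<open>i\<close>, so component \<open>i\<close> of \<open>R s *v h s\<close> is
  the mean reward rate at that time. \<open>R\<close> and \<open>h\<close> are kept abstract so that
  constant and switched controls are both instances.\<close>

lemma value_of_eq_time_integral:
  assumes chain: "\<And>i. markov_chain (M c i) (X c i) G i"
    and law: "\<And>i j t. 0 \<le> t \<Longrightarrow> measure (M c i) {\<omega> \<in> space (M c i). X c i t \<omega> = j} = R t $ i $ j"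
    and h: "\<And>s j. 0 \<le> s \<Longrightarrow> h s $ j = mean_reward f (c s j) s j + lam * \<delta> s * control_entropy (c s j)"
    and h_int: "set_integrable lborel {0..} h"
  shows "value_of c = (LINT s:{0..}|lborel. R s *v h s)"
proof -
  have h_int': "set_integrable lborel {0..} (\<lambda>s. h s $ j)" for j
    using integrable_bounded_linear[OF bounded_linear_vec_nth h_int[unfolded set_integrable_def], of j]
    by (simp add: set_integrable_def)
  have "set_integrable lborel {0..} (\<lambda>s. (R s *v h s) $ i)
    \<and> value_of c $ i = (LINT s:{0..}|lborel. (R s *v h s) $ i)" for i
  proof -
    have X: "prob_space (M c i)" "\<And>t. 0 \<le> t \<Longrightarrow> X c i t \<in> measurable (M c i) (count_space UNIV)"
      "\<And>\<omega> t. \<omega> \<in> space (M c i) \<Longrightarrow> 0 \<le> t \<Longrightarrow> \<forall>\<^sub>F s in at_right t. X c i s \<omega> = X c i t \<omega>"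
      using chain[of i] by (auto simp: markov_chain_def)
    have sum_eq: "(\<Sum>j\<in>UNIV. measure (M c i) {\<omega> \<in> space (M c i). X c i s \<omega> = j} * h s $ j) = (R s *v h s) $ i"
      if "s \<in> {0..}" for s
      using that by (simp add: law matrix_vector_mult_def)
    have "value_of c $ i = (\<integral>\<omega>. (LINT s:{0..}|lborel. h s $ X c i s \<omega>) \<partial>M c i)"
      unfolding value_fn_def vec_lambda_beta
      by (intro Bochner_Integration.integral_cong refl set_lebesgue_integral_cong) (auto simp: h)
    also have "\<dots> = (LINT s:{0..}|lborel. \<Sum>j\<in>UNIV. measure (M c i) {\<omega> \<in> space (M c i). X c i s \<omega> = j} * h s $ j)"
      by (rule expectation_time_integral(1)[OF X h_int'])
    also have "\<dots> = (LINT s:{0..}|lborel. (R s *v h s) $ i)"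
      by (rule set_lebesgue_integral_cong) (use sum_eq in auto)
    finally have "value_of c $ i = (LINT s:{0..}|lborel. (R s *v h s) $ i)" .
    moreover have "set_integrable lborel {0..} (\<lambda>s. (R s *v h s) $ i)"
      by (rule set_integrable_cong[THEN iffD1, OF refl refl sum_eq expectation_time_integral(2)[OF X h_int']])
    ultimately show ?thesis by simp
  qed
  then have "set_integrable lborel {0..} (\<lambda>s. R s *v h s)"
    and "\<And>i. value_of c $ i = (LINT s:{0..}|lborel. (R s *v h s) $ i)"
    by (auto intro: set_integrable_vec)
  then show ?thesis
    by (simp add: vec_eq_iff set_integral_vec_nth)
qed

text \<open>Row \<open>i\<close> of the controlled generator involves only \<open>\<pi> i\<close>,
  which is why the first-order condition decouples over the states. Boundedness of
  \<open>f 0 i\<close> and \<open>q\<close> allows the finite sum and the reward to be gathered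
  under one integral.\<close>

lemma hamiltonian_eq:
  assumes \<pi>: "\<pi> \<in> regular_controls U"
  shows "(reward_rate \<pi> 0 + controlled_generator q \<pi> *v y) $ i = hamiltonian y i (\<pi> i)"
proof -
  interpret prob_space "\<pi> i"
    by (rule regular_control_measure[OF \<pi>])
  obtain B where B: "\<And>u. u \<in> U \<Longrightarrow> \<bar>f 0 i u\<bar> \<le> B"
    using f_bdd by (metis atLeastAtMost_iff less_eq_real_def order_refl)
  obtain C where C: "\<And>u. u \<in> U \<Longrightarrow> norm (q u) \<le> C"
    using q_bdd by (auto simp: bounded_iff)
  have q_int: "integrable (\<pi> i) (\<lambda>u. q u $ i $ j)" for j
  proof (rule integrable_const_bound[where B = C])
    show "AE u in \<pi> i. norm (q u $ i $ j) \<le> C"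
      using C regular_control_measure(2)[OF \<pi>]
      by (intro AE_I2) (metis Finite_Cartesian_Product.norm_nth_le order_trans)
    show "(\<lambda>u. q u $ i $ j) \<in> borel_measurable (\<pi> i)"
      by (rule regular_control_measure(3)[OF \<pi> q_meas])
  qed
  have f_int: "integrable (\<pi> i) (\<lambda>u. f 0 i u)"
  proof (rule integrable_const_bound[where B = B])
    show "AE u in \<pi> i. norm (f 0 i u) \<le> B"
      using B regular_control_measure(2)[OF \<pi>] by (intro AE_I2) simp
  qed (rule regular_control_measure(3)[OF \<pi> f_meas[OF order_refl]])
  have "(controlled_generator q \<pi> *v y) $ i = (\<integral>u. q u $ i \<bullet> y \<partial>\<pi> i)"
    using q_int by (simp add: controlled_generator_def matrix_vector_mult_def inner_vec_def)
  moreover have "integrable (\<pi> i) (\<lambda>u. q u $ i \<bullet> y)"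
    unfolding inner_vec_def using q_int by simp
  ultimately show ?thesis
    using f_int by (simp add: hamiltonian_def reward_rate_def mean_reward_def \<delta>_0)
qed

lemma switch_quotient_tendsto:
  assumes \<pi>: "\<pi> \<in> regular_controls U" and \<pi>': "\<pi>' \<in> regular_controls U"
  defines "V \<equiv> value_of (\<lambda>t. \<pi>)"
  shows "((\<lambda>\<epsilon>. (value_of (switch \<epsilon> \<pi>' \<pi>) $ i - V $ i) / \<epsilon>)
    \<longlongrightarrow> hamiltonian V i (\<pi>' i) - hamiltonian V i (\<pi> i)) (at_right 0)"
proof -
  obtain P where P: "transition_function (\<lambda>_. controlled_generator q \<pi>) P"
    and law: "\<And>i j t. 0 \<le> t \<Longrightarrow> measure (M (\<lambda>t. \<pi>) i) {\<omega> \<in> space (M (\<lambda>t. \<pi>) i). X (\<lambda>t. \<pi>) i t \<omega> = j} = P 0 t $ i $ j"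
    and C: "\<And>s x. 0 \<le> s \<Longrightarrow> norm (P 0 s *v x) \<le> real CARD('d) * real CARD('d) * norm x"
    by (rule regular_control_transition[OF \<pi>]) blast
  obtain P' where P': "transition_function (\<lambda>_. controlled_generator q \<pi>') P'"
    and C': "\<And>s x. 0 \<le> s \<Longrightarrow> norm (P' 0 s *v x) \<le> real CARD('d) * real CARD('d) * norm x"
    by (rule regular_control_transition[OF \<pi>']) blast
  note int = reward_rate_integrable[OF \<pi>] and int' = reward_rate_integrable[OF \<pi>']
  have V: "V = (LINT s:{0..}|lborel. P 0 s *v reward_rate \<pi> s)"
    unfolding V_def
    by (rule value_of_eq_time_integral[OF chain[OF \<pi>] law _ int]) (auto simp: reward_rate_def)
  have W: "value_of (switch \<epsilon> \<pi>' \<pi>) = (LINT s:{0..}|lborel. (if s < \<epsilon> then P' 0 s else P' 0 \<epsilon> ** P 0 (s - \<epsilon>))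
      *v (if s < \<epsilon> then reward_rate \<pi>' s else reward_rate \<pi> s))" if "0 < \<epsilon>" for \<epsilon>
  proof (rule value_of_eq_time_integral[OF chain_switch[OF \<pi> \<pi>' that]])
    fix i j and t :: real assume "0 \<le> t"
    have gen: "(\<lambda>t. controlled_generator q (switch \<epsilon> \<pi>' \<pi> t))
        = (\<lambda>t. if t < \<epsilon> then controlled_generator q \<pi>' else controlled_generator q \<pi>)"
      by (auto simp: switch_def)
    have "markov_chain (M (switch \<epsilon> \<pi>' \<pi>) i) (X (switch \<epsilon> \<pi>' \<pi>) i)
        (\<lambda>t. if t < \<epsilon> then controlled_generator q \<pi>' else controlled_generator q \<pi>) i"
      using chain_switch[OF \<pi> \<pi>' that, of i] by (simp only: gen)
    \<comment> \<open>\<open>R\<close> may vary with the initial state, but the switching lemma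
      expresses it through \<open>P\<close> and \<open>P'\<close>, which do not.\<close>
    then obtain R where R: "transition_function (\<lambda>t. if t < \<epsilon> then controlled_generator q \<pi>' else controlled_generator q \<pi>) R"
      and "measure (M (switch \<epsilon> \<pi>' \<pi>) i) {\<omega> \<in> space (M (switch \<epsilon> \<pi>' \<pi>) i). X (switch \<epsilon> \<pi>' \<pi>) i t \<omega> = j} = R 0 t $ i $ j"
      by (rule markov_chain_law) (use \<open>0 \<le> t\<close> in blast)
    then show "measure (M (switch \<epsilon> \<pi>' \<pi>) i) {\<omega> \<in> space (M (switch \<epsilon> \<pi>' \<pi>) i). X (switch \<epsilon> \<pi>' \<pi>) i t \<omega> = j}
        = (if t < \<epsilon> then P' 0 t else P' 0 \<epsilon> ** P 0 (t - \<epsilon>)) $ i $ j"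
      using transition_function_switch[OF P P' R] \<open>0 \<le> t\<close> that by simp
  next
    show "set_integrable lborel {0..} (\<lambda>s. if s < \<epsilon> then reward_rate \<pi>' s else reward_rate \<pi> s)"
      by (rule set_integrable_if_less[OF int int' that])
  qed (auto simp: reward_rate_def switch_def)
  have "((\<lambda>\<epsilon>. (value_of (switch \<epsilon> \<pi>' \<pi>) - V) /\<^sub>R \<epsilon>)
      \<longlongrightarrow> (reward_rate \<pi>' 0 + controlled_generator q \<pi>' *v V)
        - (reward_rate \<pi> 0 + controlled_generator q \<pi> *v V)) (at_right 0)"
  proof (rule Lim_transform_eventually)
    show "((\<lambda>\<epsilon>. ((LINT s:{0..}|lborel. (if s < \<epsilon> then P' 0 s else P' 0 \<epsilon> ** P 0 (s - \<epsilon>))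
        *v (if s < \<epsilon> then reward_rate \<pi>' s else reward_rate \<pi> s)) - V) /\<^sub>R \<epsilon>)
        \<longlongrightarrow> (reward_rate \<pi>' 0 + controlled_generator q \<pi>' *v V)
        - (reward_rate \<pi> 0 + controlled_generator q \<pi> *v V)) (at_right 0)"
      unfolding V
      by (rule switched_value_derivative[OF P P' C C' int int' reward_rate_continuous[OF \<pi>] reward_rate_continuous[OF \<pi>']])
  qed (use W in \<open>auto intro: eventually_mono[OF eventually_at_right_less[of 0]]\<close>)
  from tendsto_vec_nth[OF this, of i] show ?thesis
    unfolding vector_minus_component[of _ _ i] hamiltonian_eq[OF \<pi>] hamiltonian_eq[OF \<pi>']
    by (simp add: divide_inverse mult.commute)
qed

text \<open>The quotients converge, so their \<open>Limsup\<close> is the limit and \<epsilon>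
  disappears from the equilibrium condition.\<close>

lemma regular_relaxed_equilibrium_iff_hamiltonian_maximal:
  assumes \<pi>: "\<pi> \<in> regular_controls U"
  defines "V \<equiv> value_of (\<lambda>t. \<pi>)"
  shows "regular_relaxed_equilibrium U f \<delta> lam M X \<pi> \<longleftrightarrow>
    (\<forall>\<pi>'\<in>regular_controls U. \<forall>i. hamiltonian V i (\<pi>' i) \<le> hamiltonian V i (\<pi> i))"
proof -
  have "Limsup (at_right 0) (\<lambda>\<epsilon>. ereal ((value_of (switch \<epsilon> \<pi>' \<pi>) $ i - V $ i) / \<epsilon>))
      = ereal (hamiltonian V i (\<pi>' i) - hamiltonian V i (\<pi> i))" if "\<pi>' \<in> regular_controls U" for \<pi>' i
    unfolding V_def
    by (intro lim_imp_Limsup tendsto_ereal switch_quotient_tendsto[OF \<pi> that]) simp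
  then show ?thesis
    using \<pi> unfolding regular_relaxed_equilibrium_def V_def by simp
qed

text \<open>The variational principle is applied in one state to
  \<open>f 0 i u + q u $ i \<bullet> y\<close>, which is bounded by \<open>f_bdd\<close> at time 0,
  \<open>q_bdd\<close> and Cauchy-Schwarz. Competitors appear as regular controls because these
  provide densities whose entropy exceeds -\<infinity>.\<close>

lemma hamiltonian_gibbs:
  fixes y i
  defines "\<Gamma> \<equiv> gibbs U f q lam y i"
  shows "\<Gamma> \<in> densities U" "diff_entropy U \<Gamma> > -\<infinity>"
    and "\<And>\<pi>. \<pi> \<in> regular_controls U \<Longrightarrow> hamiltonian y i (\<pi> i) \<le> hamiltonian y i (density_measure U \<Gamma>)"
    and "\<And>\<pi>. \<pi> \<in> regular_controls U \<Longrightarrow> hamiltonian y i (density_measure U \<Gamma>) \<le> hamiltonian y i (\<pi> i) \<Longrightarrow>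
      density_measure U \<Gamma> = \<pi> i"
proof -
  let ?h = "\<lambda>u. f 0 i u + q u $ i \<bullet> y"
  obtain B where B: "\<And>u. u \<in> U \<Longrightarrow> \<bar>f 0 i u\<bar> \<le> B"
    using f_bdd by (metis atLeastAtMost_iff less_eq_real_def order_refl)
  obtain C where C: "\<And>u. u \<in> U \<Longrightarrow> norm (q u) \<le> C"
    using q_bdd by (auto simp: bounded_iff)
  have h_bdd: "\<bar>?h u\<bar> \<le> B + C * norm y" if "u \<in> U" for u
  proof -
    have "\<bar>q u $ i \<bullet> y\<bar> \<le> norm (q u $ i) * norm y"
      by (rule Cauchy_Schwarz_ineq2)
    also have "\<dots> \<le> C * norm y"
      using C[OF that] by (intro mult_right_mono order_trans[OF Finite_Cartesian_Product.norm_nth_le]) auto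
    finally show ?thesis
      using B[OF that] by linarith
  qed
  have [measurable]: "(\<lambda>u. f 0 i u) \<in> borel_measurable (leb U)" "(\<lambda>u. q u $ i $ j) \<in> borel_measurable (leb U)" for j
    unfolding measurable_cong_sets[OF sets_leb refl] by (rule f_meas[OF order_refl] q_meas)+
  have h_meas: "?h \<in> borel_measurable (leb U)"
    unfolding inner_vec_def by measurable
  have \<Gamma>: "\<Gamma> = (\<lambda>u. exp (1 / lam * ?h u) / (\<integral>v. exp (1 / lam * ?h v) \<partial>leb U))"
    by (simp add: \<Gamma>_def gibbs_def fun_eq_iff)
  note principle = gibbs_variational_principle[OF compact_U U_pos h_meas h_bdd lam_pos, folded \<Gamma>]
  show \<Gamma>_dens: "\<Gamma> \<in> densities U" and "diff_entropy U \<Gamma> > -\<infinity>"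
    by (rule principle; assumption)+
  have ham: "hamiltonian y i (density_measure U \<rho>)
      = (\<integral>u. ?h u \<partial>density_measure U \<rho>) + lam * real_of_ereal (diff_entropy U \<rho>)" if "\<rho> \<in> densities U" for \<rho>
    by (simp add: hamiltonian_def measure_entropy_density_measure[OF compact_U that])
  fix \<pi> :: "'d \<Rightarrow> (real^'l) measure" assume "\<pi> \<in> regular_controls U"
  then obtain \<rho> where \<rho>: "\<rho> \<in> densities U" "\<pi> i = density_measure U \<rho>" "diff_entropy U \<rho> > -\<infinity>"
    by (rule regular_control_density)
  show "hamiltonian y i (\<pi> i) \<le> hamiltonian y i (density_measure U \<Gamma>)"
    unfolding \<rho>(2) ham[OF \<rho>(1)] ham[OF \<Gamma>_dens] by (rule principle(3)[OF _ \<rho>(1,3)])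
  assume "hamiltonian y i (density_measure U \<Gamma>) \<le> hamiltonian y i (\<pi> i)"
  then show "density_measure U \<Gamma> = \<pi> i"
    unfolding \<rho>(2) ham[OF \<rho>(1)] ham[OF \<Gamma>_dens] by (rule principle(4)[OF _ \<rho>(1,3), rotated])
qed

text \<open>This makes the Gibbs update an admissible deviation in the equilibrium
  condition.\<close>

lemma gibbs_update_regular: "gibbs_update U f q \<delta> lam M X \<pi> \<in> regular_controls U"
  unfolding regular_controls_def relaxed_controls_def prob_measures_def gibbs_update_def
  using hamiltonian_gibbs(1,2) prob_space_density_measure[OF hamiltonian_gibbs(1)] by auto

text \<open>The Hamiltonian is taken at the value of \<pi> itself throughout. An equilibrium gains
  nothing by deviating to its own Gibbs update, although the Gibbs measure is maximal; the resulting
  tie in every state forces equality by uniqueness of the maximizer. Conversely, a fixed point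
  consists of Gibbs measures and so is maximal in every state.\<close>

lemma regular_relaxed_equilibrium_iff_gibbs_fixed_point:
  fixes \<pi> :: "'d \<Rightarrow> (real^'l) measure"
  assumes \<pi>: "\<pi> \<in> regular_controls U"
  shows "regular_relaxed_equilibrium U f \<delta> lam M X \<pi> \<longleftrightarrow> gibbs_update U f q \<delta> lam M X \<pi> = \<pi>"
  unfolding regular_relaxed_equilibrium_iff_hamiltonian_maximal[OF \<pi>]
proof
  assume max: "\<forall>\<pi>'\<in>regular_controls U. \<forall>i.
    hamiltonian (value_of (\<lambda>t. \<pi>)) i (\<pi>' i) \<le> hamiltonian (value_of (\<lambda>t. \<pi>)) i (\<pi> i)"
  show "gibbs_update U f q \<delta> lam M X \<pi> = \<pi>"
  proof
    fix i
    show "gibbs_update U f q \<delta> lam M X \<pi> i = \<pi> i"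
      using bspec[OF max gibbs_update_regular[of \<pi>]] hamiltonian_gibbs(4)[OF \<pi>]
      by (simp add: gibbs_update_def)
  qed
next
  assume fix_eq: "gibbs_update U f q \<delta> lam M X \<pi> = \<pi>"
  show "\<forall>\<pi>'\<in>regular_controls U. \<forall>i.
    hamiltonian (value_of (\<lambda>t. \<pi>)) i (\<pi>' i) \<le> hamiltonian (value_of (\<lambda>t. \<pi>)) i (\<pi> i)"
  proof (intro ballI allI)
    fix \<pi>' :: "'d \<Rightarrow> (real^'l) measure" and i
    assume "\<pi>' \<in> regular_controls U"
    then show "hamiltonian (value_of (\<lambda>t. \<pi>)) i (\<pi>' i) \<le> hamiltonian (value_of (\<lambda>t. \<pi>)) i (\<pi> i)"
      using hamiltonian_gibbs(3)[of \<pi>' "value_of (\<lambda>t. \<pi>)" i] fun_cong[OF fix_eq, of i]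
      by (simp add: gibbs_update_def)
  qed
qed

end

theorem proposition3p1:
  fixes U :: "(real^'l) set"
    and q :: "real^'l \<Rightarrow> real^'d^'d"
    and f :: "real \<Rightarrow> 'd \<Rightarrow> real^'l \<Rightarrow> real"
    and \<delta> :: "real \<Rightarrow> real"
    and lam :: real
    and M :: "(real \<Rightarrow> 'd \<Rightarrow> (real^'l) measure) \<Rightarrow> 'd \<Rightarrow> 'w measure"
    and X :: "(real \<Rightarrow> 'd \<Rightarrow> (real^'l) measure) \<Rightarrow> 'd \<Rightarrow> real \<Rightarrow> 'w \<Rightarrow> 'd"
    and \<pi> :: "'d \<Rightarrow> (real^'l) measure"
  assumes "compact U" and "emeasure lborel U > 0"
    and "\<And>u. u \<in> U \<Longrightarrow> rate_matrix (q u)"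
    and "\<And>i j. (\<lambda>u. q u $ i $ j) \<in> borel_measurable (restrict_space borel U)"
    and "bounded (q ` U)"
    and "\<And>t. t \<ge> 0 \<Longrightarrow> 0 \<le> \<delta> t \<and> \<delta> t \<le> 1"
    and "antimono_on {0..} \<delta>" and "\<delta> 0 = 1" and "continuous_on {0..} \<delta>"
    and "\<And>t i. t \<ge> 0 \<Longrightarrow> (\<lambda>u. f t i u) \<in> borel_measurable (restrict_space borel U)"
    and "\<And>i u. u \<in> U \<Longrightarrow> continuous_on {0..} (\<lambda>t. f t i u)"
    and "\<exists>T>0. \<exists>B. \<forall>t\<in>{0..T}. \<forall>i. \<forall>u\<in>U. \<bar>f t i u\<bar> \<le> B"
    and "(\<integral>\<^sup>+s\<in>{0..}. ((SUP i. SUP u\<in>U. ennreal \<bar>f s i u\<bar>) + ennreal (\<delta> s)) \<partial>lborel) < \<infinity>"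
    and "\<And>\<pi> i. \<pi> \<in> regular_controls U \<Longrightarrow>
           markov_chain (M (\<lambda>t. \<pi>) i) (X (\<lambda>t. \<pi>) i) (\<lambda>t. controlled_generator q \<pi>) i"
    and "\<And>\<pi> \<pi>' \<epsilon> i. \<pi> \<in> regular_controls U \<Longrightarrow> \<pi>' \<in> regular_controls U \<Longrightarrow> \<epsilon> > 0 \<Longrightarrow>
           markov_chain (M (switch \<epsilon> \<pi>' \<pi>) i) (X (switch \<epsilon> \<pi>' \<pi>) i)
             (\<lambda>t. controlled_generator q (switch \<epsilon> \<pi>' \<pi> t)) i"
    and "lam > 0" and "\<pi> \<in> regular_controls U"
  shows "regular_relaxed_equilibrium U f \<delta> lam M X \<pi> \<longleftrightarrow> gibbs_update U f q \<delta> lam M X \<pi> = \<pi>"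
proof -
  interpret relaxed_control_problem U q f \<delta> lam M X
    by unfold_locales (fact assms)+
  show ?thesis
    by (rule regular_relaxed_equilibrium_iff_gibbs_fixed_point) fact
qed

end
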